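(* Let $\alpha>1/2$ be real and let $\boldsymbol{\gamma}=(\gamma_u)_u$, $\boldsymbol{\gamma}'=(\gamma'_u)_u$ be families of non-negative real weights such that $\gamma_v\ge\gamma_u$ whenever $v\subset u$. For $s,N\in\mathbb{N}$ let $\boldsymbol{z}\in\{1,\ldots,N-1\}^s$ be a vector constructed by the component-by-component (CBC) algorithm for lattice rules based on the criterion $P_{\alpha,\boldsymbol{\gamma},N}$. Then the following holds. 1. (General weights.) Assume that there exist $\lambda,\delta,q,q',q''\ge0$ such that $1/(2\alpha)<\lambda<1$, $0<\delta<1/(\alpha\lambda)$, $$\sup_{s\in\mathbb{N}}\frac1{s^q}\sum_{\emptyset\ne u\subseteq\{1,\ldots,s\}}\gamma_u^\lambda(2\zeta(2\alpha\lambda))^{|u|}<\infty,\qquad \sup_{s\in\mathbb{N}}\frac1{s^{q'}}\sum_{\emptyset\ne u\subseteq\{1,\ldots,s\}}\gamma'_u|u|<\infty,$$ and $$\sup_{s,N\in\mathbb{N}}\frac1{s^{q''}(\varphi(N))^\delta}\sum_{\emptyset\ne u\subseteq\{1,\ldots,s\}}\frac{\gamma'_u}{\gamma_u^{1/(2\alpha)}}(2\log_2N)^{|u|}<\infty.$$ Then the weighted star discrepancy $D^*_{\boldsymbol{\gamma}',N}(\boldsymbol{z})$ depends only polynomially on $s$: there is a constant $C>0$ independent of $s$ and $N$ such that $$D^*_{\boldsymbol{\gamma}',N}(\boldsymbol{z})\le C\,s^{\max(q',\,q/(2\alpha\lambda)+q'')}(\varphi(N))^{-1/(2\alpha\lambda)+\delta}.$$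 If there exist $\lambda,\delta$ with $1/(2\alpha)<\lambda<1$ and $0<\delta<1/(\alpha\lambda)$ such that $$\sup_{s\in\mathbb{N}}\sum_{\emptyset\ne u\subseteq\{1,\ldots,s\}}\gamma_u^\lambda(2\zeta(2\alpha\lambda))^{|u|}<\infty,\qquad \sup_{s\in\mathbb{N}}\sum_{\emptyset\ne u\subseteq\{1,\ldots,s\}}\gamma'_u|u|<\infty,$$ and $$\sup_{s,N\in\mathbb{N}}\frac1{(\varphi(N))^\delta}\sum_{\emptyset\ne u\subseteq\{1,\ldots,s\}}\frac{\gamma'_u}{\gamma_u^{1/(2\alpha)}}(2\log_2N)^{|u|}<\infty$$ (the case $q=q'=q''=0$), then $D^*_{\boldsymbol{\gamma}',N}(\boldsymbol{z})$ is bounded independently of $s$. 2. (Product weights.) Suppose $\boldsymbol{\gamma}$ and $\boldsymbol{\gamma}'$ are product weights, $\gamma_u=\prod_{j\in u}\gamma_j$ and $\gamma'_u=\prod_{j\in u}\gamma'_j$ with $\gamma_j,\gamma'_j\ge0$, and that there exists $\lambda\in(1/(2\alpha),1]$ such that $$\sum_{j=1}^\infty\gamma_j^\lambda<\infty\quad\text{and}\quad\sum_{j=1}^\infty\frac{\gamma'_j}{\gamma_j^{1/(2\alpha)}}<\infty.$$ Then for arbitrarily small $\delta>0$ there is a constant $C>0$ (which may depend on $\delta$) independent of $s$ and $N$ such that $$D^*_{\boldsymbol{\gamma}',N}(\boldsymbol{z})\le C(\varphi(N))^{-1/(2\alpha\lambda)+\delta}.$$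
   Context: $\mathbb{N}$ is the set of positive integers, $\zeta$ the Riemann zeta function, $\varphi$ the Euler totient function. Weights are families $\boldsymbol{\gamma}=(\gamma_u)$ of non-negative reals indexed by the finite non-empty subsets $u\subset\mathbb{N}$. Since $\boldsymbol{z}\in\{1,\ldots,N-1\}^s$, the conclusions concern $N\ge2$. The lattice point set $P(\boldsymbol{z})$ consists of the $N$ points (counted with multiplicity) $\boldsymbol{x}_n=(\{nz_1/N\},\ldots,\{nz_s/N\})$, $n=0,\ldots,N-1$, where $\{\cdot\}$ is the fractional part. Weighted star discrepancy: for a point set $P$ of $N$ points in $[0,1)^s$ and non-empty $u\subseteq\{1,\ldots,s\}$, let $P_u$ be the projection (with multiplicity) of $P$ onto the coordinates in $u$. For $\boldsymbol{y}_u\in[0,1)^{|u|}$ let $$\Delta_{P_u}(\boldsymbol{y}_u)=\frac1N\sum_{\boldsymbol{x}_u\in P_u}1_{[\boldsymbol{0},\boldsymbol{y}_u)}(\boldsymbol{x}_u)-\prod_{j\in u}y_j,\qquad [\boldsymbol{0},\boldsymbol{y}_u)=\prod_{j\in u}[0,y_j),$$ and $$D^*_{\boldsymbol{\gamma},N}(P)=\max_{\emptyset\ne u\subseteq\{1,\ldots,s\}}\gamma_u\sup_{\boldsymbol{y}_u\in[0,1)^{|u|}}|\Delta_{P_u}(\boldsymbol{y}_u)|.$$ Write $D^*_{\boldsymbol{\gamma},N}(\boldsymbol{z})=D^*_{\boldsymbol{\gamma},N}(P(\boldsymbol{z}))$. Criterion: for $\boldsymbol{z}\in\{1,\ldots,N-1\}^s$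 and non-empty $u\subseteq\{1,\ldots,s\}$ let $$P_u^\perp(\boldsymbol{z})=\Bigl\{\boldsymbol{k}_u\in(\mathbb{Z}\setminus\{0\})^{|u|} : \sum_{j\in u}k_jz_j\equiv0 \pmod N\Bigr\},$$ $$P_{\alpha,\boldsymbol{\gamma},N}(\boldsymbol{z})=\sum_{\emptyset\ne u\subseteq\{1,\ldots,s\}}\ \sum_{\boldsymbol{k}_u\in P_u^\perp(\boldsymbol{z})}\gamma_u\prod_{j\in u}\frac1{|k_j|^{2\alpha}}.$$ The same definition is used for vectors of any length $\ell$ (with $s$ replaced by $\ell$). CBC algorithm for lattice rules based on $P_{\alpha,\boldsymbol{\gamma},N}$: set $z^*_1=1$; for $\ell=1,\ldots,s-1$ successively, with $z^*_1,\ldots,z^*_\ell$ kept fixed, let $z^*_{\ell+1}$ be a minimizer of $P_{\alpha,\boldsymbol{\gamma},N}(z^*_1,\ldots,z^*_\ell,z_{\ell+1})$ over $z_{\ell+1}\in\{1,\ldots,N-1\}$. The output is $\boldsymbol{z}=(z^*_1,\ldots,z^*_s)$. Convention: $0/0=0$, and $c/0=+\infty$ for $c>0$, in the ratios of weights. *)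

theory Defs
  imports "HOL-Analysis.Analysis" "HOL-Number_Theory.Totient" "HOL-Library.Multiset"
begin

(* A vector of length s is a function on nat of which only the values at 1, ..., s matter;
   a vector indexed by a finite set u is an extensional function, i.e. an element of PiE u. *)

definition weight_index :: "nat set set" where
  "weight_index = {u. finite u \<and> u \<noteq> {} \<and> u \<subseteq> {1..}}"

definition coord_sets :: "nat \<Rightarrow> nat set set" where
  "coord_sets s = {u. u \<noteq> {} \<and> u \<subseteq> {1..s}}"

definition weights :: "(nat set \<Rightarrow> real) \<Rightarrow> bool" where
  "weights \<gamma> \<longleftrightarrow> (\<forall>u\<in>weight_index. \<gamma> u \<ge> 0)"

definition product_weights :: "(nat set \<Rightarrow> real) \<Rightarrow> (nat \<Rightarrow> real) \<Rightarrow> bool" where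
  "product_weights \<gamma> g \<longleftrightarrow> (\<forall>j\<ge>1. g j \<ge> 0) \<and> (\<forall>u\<in>weight_index. \<gamma> u = (\<Prod>j\<in>u. g j))"

(* Riemann's zeta function on the real half-line x > 1, the only part used. *)
definition zeta :: "real \<Rightarrow> real" where
  "zeta x = (\<Sum>n. 1 / real (Suc n) powr x)"

(* Point sets are multisets, so that points and their projections count with multiplicity. *)

definition lattice_points :: "nat \<Rightarrow> nat \<Rightarrow> (nat \<Rightarrow> nat) \<Rightarrow> (nat \<Rightarrow> real) multiset" where
  "lattice_points s N z =
     image_mset (\<lambda>n. \<lambda>j\<in>{1..s}. frac (real n * real (z j) / real N)) (mset_set {0..<N})"

definition projection :: "nat set \<Rightarrow> (nat \<Rightarrow> real) multiset \<Rightarrow> (nat \<Rightarrow> real) multiset" where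
  "projection u P = image_mset (\<lambda>x. restrict x u) P"

definition local_discrepancy ::
    "nat set \<Rightarrow> (nat \<Rightarrow> real) multiset \<Rightarrow> (nat \<Rightarrow> real) \<Rightarrow> real" where
  "local_discrepancy u Pu y =
     1 / real (size Pu) * (\<Sum>x\<in>#Pu. indicator (\<Pi>\<^sub>E j\<in>u. {0..<y j}) x) - (\<Prod>j\<in>u. y j)"

definition weighted_star_discrepancy ::
    "(nat set \<Rightarrow> real) \<Rightarrow> nat \<Rightarrow> (nat \<Rightarrow> real) multiset \<Rightarrow> real" where
  "weighted_star_discrepancy \<gamma> s P =
     Max ((\<lambda>u. \<gamma> u * (SUP y\<in>(\<Pi>\<^sub>E j\<in>u. {0..<1}). \<bar>local_discrepancy u (projection u P) y\<bar>))
            ` coord_sets s)"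

definition dual_lattice :: "nat \<Rightarrow> (nat \<Rightarrow> nat) \<Rightarrow> nat set \<Rightarrow> (nat \<Rightarrow> int) set" where
  "dual_lattice N z u =
     {k \<in> (\<Pi>\<^sub>E j\<in>u. UNIV - {0}). [(\<Sum>j\<in>u. k j * int (z j)) = 0] (mod int N)}"

(* The inner sums are infinite; they converge absolutely for \<alpha> > 1/2. *)
definition P_criterion ::
    "real \<Rightarrow> (nat set \<Rightarrow> real) \<Rightarrow> nat \<Rightarrow> nat \<Rightarrow> (nat \<Rightarrow> nat) \<Rightarrow> real" where
  "P_criterion \<alpha> \<gamma> N l z =
     (\<Sum>u\<in>coord_sets l. \<Sum>\<^sub>\<infinity>k\<in>dual_lattice N z u.
        \<gamma> u * (\<Prod>j\<in>u. 1 / \<bar>real_of_int (k j)\<bar> powr (2 * \<alpha>)))"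

(* Minimizers need not be unique, so the algorithm is given by its possible outputs. *)
definition cbc_output ::
    "real \<Rightarrow> (nat set \<Rightarrow> real) \<Rightarrow> nat \<Rightarrow> nat \<Rightarrow> (nat \<Rightarrow> nat) \<Rightarrow> bool" where
  "cbc_output \<alpha> \<gamma> N s z \<longleftrightarrow>
     z 1 = 1 \<and>
     (\<forall>l\<in>{1..<s}. is_arg_min (\<lambda>x. P_criterion \<alpha> \<gamma> N (l + 1) (z(l + 1 := x)))
                             (\<lambda>x. x \<in> {1..N - 1}) (z (l + 1)))"

(* In ennreal, 0 / 0 = 0 and c / 0 = \<infinity> for c > 0. *)
definition weight_ratio :: "real \<Rightarrow> real \<Rightarrow> real \<Rightarrow> ennreal" where
  "weight_ratio \<alpha> c' c = ennreal c' / ennreal (c powr (1 / (2 * \<alpha>)))"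

end

theory Submission
  imports Defs "HOL-Library.Real_Mod" "HOL-Library.Log_Nat"
begin

text \<open>The constructed vector satisfies
  P(z)^\<lambda> \<le> 1/\<phi>(N) * (sum over u of \<gamma>_u^\<lambda> (2 \<zeta>(2 \<alpha> \<lambda>))^|u|): the minimum over the last component is at
  most the mean over the units modulo N, and Jensen's inequality (sum a)^\<lambda> \<le> sum a^\<lambda> makes this mean
  computable.

  On the other side, finite Fourier analysis modulo N bounds the star discrepancy of the
  projection to u by |u|/N plus the sum of the products of 1 / max(1, 2|k_j|) over the nonzero dual
  lattice points k with |k_j| \<le> N/2. Every such k satisfies
  (product of max(1, |k_j|)) \<ge> \<rho> := (\<gamma>_u / P(z))^(1/(2 \<alpha>)), because the weights decrease in u.
  Each coordinate falls into one of at most 2 log_2 N + 1 signed dyadic classes, and a packing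
  argument shows that each combination of classes contributes at most 1/\<rho> to the sum. Since
  2 log_2 N + 1 \<le> 2 log_2 (2N), the third hypothesis, used for 2N in place of N, absorbs the
  logarithms at the cost of a constant factor.\<close>

subsection \<open>Sums over nonzero integers and the zeta function\<close>

text \<open>The criterion controls sums of products of |k_j|^(-2 \<alpha>), while the discrepancy
  leads to the exponent 1. Jensen's inequality between these exponents points the wrong way, and
  with exponent 1 the sum over the whole dual lattice diverges; hence the truncation |k_j| \<le> N/2
  and the detour through a lower bound \<rho> for the products, which a single term of the criterion
  provides. The hypotheses leave room for little more than a factor 2 log_2 N per coordinate, and a
  constant lost in one coordinate would enter to the power |u|; this dictates the sharp weight
  1/(2|k|) and the count of signed classes. Where \<gamma>_u = 0 the criterion yields no \<rho>, but
  there the convention for c/0 forces \<gamma>'_u = 0. The mean runs over units only, because a unit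
  solution of a congruence fixes the divisor of N that occurs; this is why \<phi>(N) appears in
  place of N.\<close>

lemma powr_add_le_add_powr:
  fixes x y p :: real
  assumes "x \<ge> 0" "y \<ge> 0" "0 < p" "p \<le> 1"
  shows "(x + y) powr p \<le> x powr p + y powr p"
proof (cases "x + y = 0")
  case False
  define t where "t = x + y"
  have t: "t > 0" using False assms by (simp add: t_def)
  \<comment> \<open>Normalizing the sum to 1 reduces the claim to the comparison of a number in
    [0,1] with its p-th power.\<close>
  have *: "a / t \<le> (a / t) powr p" if "0 \<le> a" "a \<le> t" for a
    using that t assms powr_mono'[of p 1 "a / t"] by simp
  have "1 = x / t + y / t" using t by (simp add: t_def add_divide_distrib[symmetric])
  also have "\<dots> \<le> (x / t) powr p + (y / t) powr p"
    using assms by (intro add_mono *) (auto simp: t_def)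
  also have "\<dots> = (x powr p + y powr p) / t powr p"
    using assms t by (simp add: powr_divide add_divide_distrib)
  finally show ?thesis using t by (simp add: field_simps t_def)
qed (use assms in auto)

lemma sum_powr_le_powr_sum:
  fixes f :: "'a \<Rightarrow> real"
  assumes "finite A" "\<And>x. x \<in> A \<Longrightarrow> f x \<ge> 0" "0 < p" "p \<le> 1"
  shows "(\<Sum>x\<in>A. f x) powr p \<le> (\<Sum>x\<in>A. f x powr p)"
  using assms(1,2)
proof (induction A rule: finite_induct)
  case (insert a A)
  have "(\<Sum>x\<in>insert a A. f x) powr p \<le> f a powr p + (\<Sum>x\<in>A. f x) powr p"
    using insert assms(3,4) by (auto intro!: powr_add_le_add_powr sum_nonneg)
  also have "\<dots> \<le> f a powr p + (\<Sum>x\<in>A. f x powr p)"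
    using insert by simp
  finally show ?case using insert by simp
qed simp

lemma infsum_powr_le_powr_infsum:
  fixes f :: "'a \<Rightarrow> real"
  assumes "f summable_on A" "(\<lambda>x. f x powr p) summable_on A"
    and nonneg: "\<And>x. x \<in> A \<Longrightarrow> f x \<ge> 0" and p: "0 < p" "p \<le> 1"
  shows "(\<Sum>\<^sub>\<infinity>x\<in>A. f x) powr p \<le> (\<Sum>\<^sub>\<infinity>x\<in>A. f x powr p)"
proof -
  \<comment> \<open>The power moves to the other side, since an infinite sum is bounded through its
    finite partial sums, where the finite inequality applies.\<close>
  have "infsum f A \<le> (\<Sum>\<^sub>\<infinity>x\<in>A. f x powr p) powr (1 / p)"
  proof (rule infsum_le_finite_sums[OF assms(1)])
    fix F assume F: "finite F" "F \<subseteq> A"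
    have "sum f F \<ge> 0" using F nonneg by (auto intro!: sum_nonneg)
    then have "sum f F = (sum f F powr p) powr (1 / p)"
      using p by (simp add: powr_powr)
    also have "\<dots> \<le> (\<Sum>x\<in>F. f x powr p) powr (1 / p)"
      using F nonneg p by (intro powr_mono2 sum_powr_le_powr_sum) auto
    also have "\<dots> \<le> (\<Sum>\<^sub>\<infinity>x\<in>A. f x powr p) powr (1 / p)"
      using F p by (intro powr_mono2 finite_sum_le_infsum[OF assms(2)] sum_nonneg) auto
    finally show "sum f F \<le> \<dots>" .
  qed
  then have "infsum f A powr p \<le> ((\<Sum>\<^sub>\<infinity>x\<in>A. f x powr p) powr (1 / p)) powr p"
    using p nonneg by (intro powr_mono2 infsum_nonneg) auto
  also have "\<dots> = (\<Sum>\<^sub>\<infinity>x\<in>A. f x powr p)"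
    using p infsum_nonneg[of A "\<lambda>x. f x powr p"] by (simp add: powr_powr)
  finally show ?thesis .
qed

lemma summable_zeta:
  assumes "t > 1" shows "summable (\<lambda>n. 1 / real (Suc n) powr t)"
proof -
  have "summable (\<lambda>n. real n powr (-t))" using assms by (simp add: summable_real_powr_iff)
  then have "summable (\<lambda>n. real (Suc n) powr (-t))" by (subst summable_Suc_iff)
  then show ?thesis by (simp add: powr_minus field_simps)
qed

lemma zeta_nonneg: "t > 1 \<Longrightarrow> zeta t \<ge> 0"
  unfolding zeta_def by (intro suminf_nonneg summable_zeta) auto

lemma sum_nonzero_int_powr_le_zeta:
  fixes G :: "int set"
  assumes "finite G" "0 \<notin> G" "t > 1"
  shows "(\<Sum>m\<in>G. \<bar>real_of_int m\<bar> powr (-t)) \<le> 2 * zeta t"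
proof -
  \<comment> \<open>Meant for integers of one sign, where \<open>nat \<bar>m\<bar> - 1\<close> is
    injective; the shift by 1 matches the \<open>Suc n\<close> in the series of
    \<open>zeta\<close>.\<close>
  have part: "(\<Sum>m\<in>H. \<bar>real_of_int m\<bar> powr (-t)) \<le> zeta t"
    if "finite H" "inj_on (\<lambda>m. nat \<bar>m\<bar> - 1) H" "0 \<notin> H" for H :: "int set"
  proof -
    have "(\<Sum>m\<in>H. \<bar>real_of_int m\<bar> powr (-t)) = (\<Sum>m\<in>H. 1 / real (Suc (nat \<bar>m\<bar> - 1)) powr t)"
    proof (intro sum.cong refl)
      fix m assume "m \<in> H"
      then have "m \<noteq> 0" using that by auto
      then have "real (Suc (nat \<bar>m\<bar> - 1)) = \<bar>real_of_int m\<bar>" by linarith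
      then show "\<bar>real_of_int m\<bar> powr (-t) = 1 / real (Suc (nat \<bar>m\<bar> - 1)) powr t"
        by (simp add: powr_minus field_simps)
    qed
    also have "\<dots> = (\<Sum>n\<in>(\<lambda>m. nat \<bar>m\<bar> - 1) ` H. 1 / real (Suc n) powr t)"
      using that by (simp add: sum.reindex)
    also have "\<dots> \<le> zeta t"
      unfolding zeta_def using that assms by (intro sum_le_suminf summable_zeta) auto
    finally show ?thesis .
  qed
  have "(\<Sum>m\<in>G. \<bar>real_of_int m\<bar> powr (-t))
      = (\<Sum>m\<in>G \<inter> {0<..}. \<bar>real_of_int m\<bar> powr (-t)) + (\<Sum>m\<in>G \<inter> {..<0}. \<bar>real_of_int m\<bar> powr (-t))"
  proof (subst sum.union_disjoint[symmetric])
    show "(\<Sum>m\<in>G. \<bar>real_of_int m\<bar> powr (-t)) = (\<Sum>m\<in>G \<inter> {0<..} \<union> G \<inter> {..<0}. \<bar>real_of_int m\<bar> powr (-t))"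
      using assms(2) by (intro sum.cong) (auto, metis linorder_neqE_linordered_idom)
  qed (use assms in auto)
  also have "\<dots> \<le> zeta t + zeta t"
    using assms by (intro add_mono part) (auto intro!: inj_onI)
  finally show ?thesis by simp
qed

subsection \<open>The component-by-component bound\<close>

text \<open>With d the gcd and N = d M, the congruence fixes x modulo M. Since x < N, the quotient
  \<open>x div M\<close> takes at most d values, and together with the residue it determines
  x.\<close>

lemma card_linear_congruence_le:
  fixes m c :: int
  assumes "N > 0" "finite X"
    and X: "\<And>x. x \<in> X \<Longrightarrow> x < N \<and> [m * int x + c = 0] (mod int N)"
  shows "card X \<le> nat (gcd m (int N))"
proof -
  define d where "d = nat (gcd m (int N))"
  have d: "int d = gcd m (int N)" "d > 0" using assms by (auto simp: d_def)
  then obtain M where M: "N = d * M" by (metis dvdE gcd_dvd2 int_dvd_int_iff)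
  have "M > 0" using M assms by (cases M) auto
  obtain m' where m': "m = int d * m'" using d by (metis dvdE gcd_dvd1)
  have cop: "coprime m' (int M)"
  proof -
    have "gcd (int d * m') (int d * int M) = int d" using d M m' by simp
    then have "int d * gcd m' (int M) = int d" by (simp add: gcd_mult_distrib_int[symmetric])
    then show ?thesis using d by (auto simp: coprime_iff_gcd_eq_1)
  qed
  have "inj_on (\<lambda>x. x div M) X"
  proof (rule inj_onI)
    fix x y assume xy: "x \<in> X" "y \<in> X" "x div M = y div M"
    have "int N dvd (m * int x + c) - (m * int y + c)"
      using X[OF xy(1)] X[OF xy(2)] by (intro dvd_diff) (auto simp: cong_0_iff)
    then have "int d * int M dvd int d * (m' * (int x - int y))"
      using M m' by (simp add: algebra_simps)
    then have "int M dvd m' * (int x - int y)" using d(2) by simp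
    then have "int M dvd int x - int y" using cop by (simp add: coprime_dvd_mult_right_iff coprime_commute)
    then have "int x mod int M = int y mod int M" by (simp add: mod_eq_dvd_iff)
    then have "x mod M = y mod M" by (simp flip: of_nat_mod)
    then show "x = y" using xy(3) by (metis div_mult_mod_eq)
  qed
  moreover have "(\<lambda>x. x div M) ` X \<subseteq> {..<d}"
    using X M \<open>M > 0\<close> by (auto simp: div_less_iff_less_mult)
  ultimately have "card X \<le> card {..<d}" by (intro card_inj_on_le) auto
  then show ?thesis by (simp add: d_def)
qed

text \<open>A unit x with m x + c = 0 forces gcd(m,N) = gcd(c,N) = d, and then there are at most d
  solutions; this factor d is absorbed by the sum over the multiples m of d, as t > 1.\<close>

lemma sum_units_congruence_le:
  fixes G :: "int set" and c :: int
  assumes "finite G" "0 \<notin> G" "t > 1" "N \<ge> 2"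
  shows "(\<Sum>m\<in>G. \<bar>real_of_int m\<bar> powr (-t) *
            real (card {x\<in>totatives N. [m * int x + c = 0] (mod int N)})) \<le> 2 * zeta t"
proof -
  define X where "X = (\<lambda>m. {x\<in>totatives N. [m * int x + c = 0] (mod int N)})"
  define d where "d = gcd c (int N)"
  have d: "d > 0" using assms by (simp add: d_def)
  have gcd: "gcd m (int N) = d" if "x \<in> X m" for m x
  proof -
    have x: "coprime (int x) (int N)" "[m * int x + c = 0] (mod int N)"
      using that by (auto simp: X_def in_totatives_iff)
    have "[m * int x = - c] (mod int N)"
      using x(2) by (simp add: cong_iff_dvd_diff)
    then have "gcd (m * int x) (int N) = gcd (- c) (int N)" by (rule cong_gcd_eq)
    then show ?thesis using x(1) unfolding d_def
      by (metis coprime_commute gcd.commute gcd_mult_right_right_cancel gcd_neg1_int)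
  qed
  have card: "real (card (X m)) \<le> of_bool (d dvd m) * real_of_int d" for m
  proof (cases "X m = {}")
    case False
    then obtain x where x: "x \<in> X m" by auto
    have "d dvd m" using gcd[OF x] by (metis gcd_dvd1)
    have "card (X m) \<le> nat (gcd m (int N))"
    proof (rule card_linear_congruence_le)
      fix x assume "x \<in> X m"
      then show "x < N \<and> [m * int x + c = 0] (mod int N)"
        using assms totatives_less[of x N] by (auto simp: X_def)
    qed (use assms in \<open>auto simp: X_def\<close>)
    then show ?thesis using gcd[OF x] \<open>d dvd m\<close> d by (simp add: nat_le_iff)
  qed (use d in auto)
  have "(\<Sum>m\<in>G. \<bar>real_of_int m\<bar> powr (-t) * real (card (X m)))
      \<le> (\<Sum>m\<in>G. \<bar>real_of_int m\<bar> powr (-t) * (of_bool (d dvd m) * real_of_int d))"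
    by (intro sum_mono mult_left_mono card) auto
  also have "\<dots> = (\<Sum>m\<in>{m\<in>G. d dvd m}. \<bar>real_of_int m\<bar> powr (-t) * real_of_int d)"
    using assms by (intro sum.mono_neutral_cong_right) auto
  also have "\<dots> \<le> (\<Sum>m\<in>{m\<in>G. d dvd m}. \<bar>real_of_int (m div d)\<bar> powr (-t))"
  proof (rule sum_mono)
    fix m assume m: "m \<in> {m\<in>G. d dvd m}"
    then obtain m' where m': "m = d * m'" by auto
    have "real_of_int d powr (-t) \<le> real_of_int d powr (-1)"
      using d assms by (intro powr_mono) auto
    then have "real_of_int d powr (-t) * real_of_int d \<le> 1"
      using d by (simp add: powr_minus field_simps)
    then have "\<bar>real_of_int m'\<bar> powr (-t) * (real_of_int d powr (-t) * real_of_int d) \<le> \<bar>real_of_int m'\<bar> powr (-t) * 1"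
      by (intro mult_left_mono) auto
    then show "\<bar>real_of_int m\<bar> powr (-t) * real_of_int d \<le> \<bar>real_of_int (m div d)\<bar> powr (-t)"
      using d by (simp add: m' abs_mult powr_mult mult_ac)
  qed
  also have "\<dots> = (\<Sum>m\<in>(\<lambda>m. m div d) ` {m\<in>G. d dvd m}. \<bar>real_of_int m\<bar> powr (-t))"
    by (subst sum.reindex) (auto intro!: inj_onI simp: dvd_div_eq_iff)
  also have "\<dots> \<le> 2 * zeta t"
    using assms by (intro sum_nonzero_int_powr_le_zeta) (auto simp: dvd_div_eq_0_iff)
  finally show ?thesis unfolding X_def .
qed

section \<open>Sums over integer vectors with nonzero coordinates\<close>

text \<open>All terms are non-negative, so F may be enlarged to the box of its coordinate
  projections, over which the sum factors.\<close>

lemma sum_prod_powr_le_zeta_power: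
  fixes F :: "('a \<Rightarrow> int) set"
  assumes "finite u" "finite F" "F \<subseteq> (\<Pi>\<^sub>E j\<in>u. UNIV - {0})" "t > 1"
  shows "(\<Sum>k\<in>F. \<Prod>j\<in>u. \<bar>real_of_int (k j)\<bar> powr (-t)) \<le> (2 * zeta t) ^ card u"
proof -
  define G where "G = (\<lambda>j. (\<lambda>k. k j) ` F)"
  have G: "finite (G j)" for j using assms by (auto simp: G_def)
  have G0: "0 \<notin> G j" if "j \<in> u" for j using assms(3) that by (fastforce simp: G_def)
  have "F \<subseteq> PiE u G"
  proof
    fix k assume "k \<in> F"
    with assms(3) have "k \<in> (\<Pi>\<^sub>E j\<in>u. UNIV - {0})" by blast
    with \<open>k \<in> F\<close> show "k \<in> PiE u G" by (auto simp: G_def PiE_iff)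
  qed
  then have "(\<Sum>k\<in>F. \<Prod>j\<in>u. \<bar>real_of_int (k j)\<bar> powr (-t))
      \<le> (\<Sum>k\<in>PiE u G. \<Prod>j\<in>u. \<bar>real_of_int (k j)\<bar> powr (-t))"
    using assms G by (intro sum_mono2 finite_PiE prod_nonneg) auto
  also have "\<dots> = (\<Prod>j\<in>u. \<Sum>m\<in>G j. \<bar>real_of_int m\<bar> powr (-t))"
    using assms G by (intro prod_sum_PiE[symmetric]) auto
  also have "\<dots> \<le> (\<Prod>j\<in>u. 2 * zeta t)"
    using assms G G0 by (intro prod_mono conjI sum_nonneg sum_nonzero_int_powr_le_zeta) auto
  finally show ?thesis by simp
qed

lemma summable_prod_powr:
  assumes "finite u" "t > 1" "A \<subseteq> (\<Pi>\<^sub>E j\<in>u. UNIV - {0::int})"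
  shows "(\<lambda>k. \<Prod>j\<in>u. \<bar>real_of_int (k j)\<bar> powr (-t)) summable_on A"
proof (rule nonneg_bounded_partial_sums_imp_summable_on)
  show "eventually (\<lambda>F. (\<Sum>k\<in>F. \<Prod>j\<in>u. \<bar>real_of_int (k j)\<bar> powr (-t)) \<le> (2 * zeta t) ^ card u)
      (finite_subsets_at_top A)"
  proof (rule eventually_finite_subsets_at_top_weakI)
    fix F assume "finite F" "F \<subseteq> A"
    then show "(\<Sum>k\<in>F. \<Prod>j\<in>u. \<bar>real_of_int (k j)\<bar> powr (-t)) \<le> (2 * zeta t) ^ card u"
      by (rule sum_prod_powr_le_zeta_power[OF assms(1) _ order_trans[OF _ assms(3)] assms(2)])
  qed
  show "(\<Prod>j\<in>u. \<bar>real_of_int (k j)\<bar> powr (-t)) \<ge> 0" for k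
    by (simp add: prod_nonneg)
qed

text \<open>Double counting, for the mean over the last component: the dual lattices of the
  candidates merge into one sum in which k counts once for every candidate it is dual to.
  Summability is proved along with the identity because the induction adds infinite sums.\<close>

lemma sum_infsum_eq_infsum_card:
  fixes f :: "'a \<Rightarrow> real"
  assumes "finite X" "f summable_on A" "\<And>x. x \<in> X \<Longrightarrow> D x \<subseteq> A"
  shows "(\<lambda>k. f k * real (card {x\<in>X. k \<in> D x})) summable_on A \<and>
    (\<Sum>x\<in>X. \<Sum>\<^sub>\<infinity>k\<in>D x. f k) = (\<Sum>\<^sub>\<infinity>k\<in>A. f k * real (card {x\<in>X. k \<in> D x}))"
  using assms(1,3)
proof (induction X rule: finite_induct)
  case (insert a X)
  let ?c = "\<lambda>X k. f k * real (card {x\<in>X. k \<in> D x})"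
  have D: "D a \<subseteq> A" using insert by auto
  have c: "?c (insert a X) k = f k * of_bool (k \<in> D a) + ?c X k" for k
  proof -
    have "{x\<in>insert a X. k \<in> D x} = (if k \<in> D a then insert a {x\<in>X. k \<in> D x} else {x\<in>X. k \<in> D x})"
      by auto
    then show ?thesis using insert.hyps by (simp add: algebra_simps)
  qed
  have s: "(\<lambda>k. f k * of_bool (k \<in> D a)) summable_on A"
    using summable_on_subset_banach[OF assms(2) D] D
    by (subst summable_on_cong_neutral[where T = "D a" and g = f]) auto
  have i: "(\<Sum>\<^sub>\<infinity>k\<in>A. f k * of_bool (k \<in> D a)) = (\<Sum>\<^sub>\<infinity>k\<in>D a. f k)"
    using D by (intro infsum_cong_neutral) auto
  have IH: "?c X summable_on A" "(\<Sum>x\<in>X. \<Sum>\<^sub>\<infinity>k\<in>D x. f k) = (\<Sum>\<^sub>\<infinity>k\<in>A. ?c X k)"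
    using insert by auto
  show ?case unfolding c using summable_on_add[OF s IH(1)] infsum_add[OF s IH(1)] i IH(2) insert.hyps
    by simp
qed auto

section \<open>Dual lattice sums and their mean over the units\<close>

text \<open>The exponent is kept free because Jensen's inequality replaces 2 \<alpha> by 2 \<alpha>
  lam.\<close>

definition dual_sum :: "real \<Rightarrow> nat \<Rightarrow> (nat \<Rightarrow> nat) \<Rightarrow> nat set \<Rightarrow> real" where
  "dual_sum t N z u = (\<Sum>\<^sub>\<infinity>k\<in>dual_lattice N z u. \<Prod>j\<in>u. \<bar>real_of_int (k j)\<bar> powr (-t))"

lemma finite_coord_sets: "finite (coord_sets s)"
  by (rule finite_subset[of _ "Pow {1..s}"]) (auto simp: coord_sets_def)

lemma coord_sets_weight_index: "u \<in> coord_sets s \<Longrightarrow> u \<in> weight_index"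
  by (auto simp: coord_sets_def weight_index_def intro: finite_subset)

lemma finite_coord_set: "u \<in> coord_sets s \<Longrightarrow> finite u"
  by (auto simp: coord_sets_def intro: finite_subset)

lemma dual_lattice_subset: "dual_lattice N z u \<subseteq> (\<Pi>\<^sub>E j\<in>u. UNIV - {0})"
  by (auto simp: dual_lattice_def)

lemma dual_lattice_cong:
  assumes "\<And>j. j \<in> u \<Longrightarrow> z j = z' j" shows "dual_lattice N z u = dual_lattice N z' u"
proof -
  have "(\<Sum>j\<in>u. k j * int (z j)) = (\<Sum>j\<in>u. k j * int (z' j))" for k
    using assms by (intro sum.cong) auto
  then show ?thesis by (simp add: dual_lattice_def)
qed

lemma dual_sum_nonneg: "dual_sum t N z u \<ge> 0"
  unfolding dual_sum_def by (intro infsum_nonneg prod_nonneg) auto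

lemma P_criterion_eq:
  "P_criterion \<alpha> \<gamma> N l z = (\<Sum>u\<in>coord_sets l. \<gamma> u * dual_sum (2 * \<alpha>) N z u)"
  unfolding P_criterion_def dual_sum_def by (simp add: infsum_cmult_right' powr_minus_divide)

text \<open>Jensen's inequality applied to the terms: a power of a product of powers only changes
  the exponent, and \<open>t * p > 1\<close> keeps the new sum finite.\<close>

lemma dual_sum_powr_le:
  assumes "finite u" "0 < p" "p \<le> 1" "t * p > 1"
  shows "dual_sum t N z u powr p \<le> dual_sum (t * p) N z u"
proof -
  have "t > 1" using assms by (smt (verit) mult_le_cancel_left2 mult_neg_pos mult_nonneg_nonpos2)
  have e: "(\<Prod>j\<in>u. \<bar>real_of_int (k j)\<bar> powr (-t)) powr p = (\<Prod>j\<in>u. \<bar>real_of_int (k j)\<bar> powr (-(t * p)))" for k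
    by (subst prod_powr_distrib) (auto simp: powr_powr)
  have "dual_sum t N z u powr p \<le> (\<Sum>\<^sub>\<infinity>k\<in>dual_lattice N z u. (\<Prod>j\<in>u. \<bar>real_of_int (k j)\<bar> powr (-t)) powr p)"
    unfolding dual_sum_def
  proof (rule infsum_powr_le_powr_infsum)
    show "(\<lambda>k. \<Prod>j\<in>u. \<bar>real_of_int (k j)\<bar> powr (-t)) summable_on dual_lattice N z u"
      using assms \<open>t > 1\<close> by (intro summable_prod_powr dual_lattice_subset) auto
    show "(\<lambda>k. (\<Prod>j\<in>u. \<bar>real_of_int (k j)\<bar> powr (-t)) powr p) summable_on dual_lattice N z u"
      unfolding e using assms by (intro summable_prod_powr dual_lattice_subset) auto
  qed (use assms in \<open>auto intro: prod_nonneg\<close>)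
  then show ?thesis by (simp add: e dual_sum_def)
qed

lemma sum_PiE_insert:
  assumes "l \<notin> v"
  shows "(\<Sum>k\<in>PiE (insert l v) G. f k) = (\<Sum>g\<in>PiE v G. \<Sum>m\<in>G l. f (g(l := m)))"
proof -
  have "(\<Sum>k\<in>PiE (insert l v) G. f k) = (\<Sum>(m, g)\<in>G l \<times> PiE v G. f (g(l := m)))"
    unfolding PiE_insert_eq using inj_combinator[OF assms, of "G"]
    by (simp add: sum.reindex case_prod_unfold)
  also have "\<dots> = (\<Sum>g\<in>PiE v G. \<Sum>m\<in>G l. f (g(l := m)))"
    by (subst sum.swap, subst sum.cartesian_product) simp
  finally show ?thesis .
qed

text \<open>For fixed coordinates on v, their linear form is the constant c of the one-dimensional
  congruence bound. That bound is uniform in c, so the remaining sum over v factors. The left side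
  has \<open>totient N\<close> summands and the right side no such factor: this is the whole gain of
  the mean.\<close>

lemma sum_units_dual_sum_le:
  assumes "finite v" "l \<notin> v" "t > 1" "N \<ge> 2"
  shows "(\<Sum>x\<in>totatives N. dual_sum t N (z(l := x)) (insert l v)) \<le> (2 * zeta t) ^ card (insert l v)"
proof -
  define D where "D = (\<lambda>x. dual_lattice N (z(l := x)) (insert l v))"
  define w where "w = (\<lambda>u (k :: nat \<Rightarrow> int). \<Prod>j\<in>u. \<bar>real_of_int (k j)\<bar> powr (-t))"
  define c where "c = (\<lambda>k. real (card {x\<in>totatives N. k \<in> D x}))"
  let ?A = "\<Pi>\<^sub>E j\<in>insert l v. UNIV - {0::int}"
  have w0: "w u k \<ge> 0" for u k by (auto simp: w_def intro: prod_nonneg)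
  have S: "(\<lambda>k. w (insert l v) k * c k) summable_on ?A \<and>
      (\<Sum>x\<in>totatives N. \<Sum>\<^sub>\<infinity>k\<in>D x. w (insert l v) k) = (\<Sum>\<^sub>\<infinity>k\<in>?A. w (insert l v) k * c k)"
    unfolding c_def w_def D_def using assms
    by (intro sum_infsum_eq_infsum_card summable_prod_powr dual_lattice_subset) auto
  have "(\<Sum>\<^sub>\<infinity>k\<in>?A. w (insert l v) k * c k) \<le> (2 * zeta t) ^ card (insert l v)"
  proof (rule infsum_le_finite_sums[OF conjunct1[OF S]])
    fix F assume F: "finite F" "F \<subseteq> ?A"
    define G where "G = (\<lambda>j. (\<lambda>k. k j) ` F)"
    have G: "finite (G j)" for j using F by (auto simp: G_def)
    have G0: "0 \<notin> G j" if "j \<in> insert l v" for j using F that by (fastforce simp: G_def)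
    have "F \<subseteq> PiE (insert l v) G"
    proof
      fix k assume "k \<in> F"
      with F have "k \<in> ?A" by blast
      with \<open>k \<in> F\<close> show "k \<in> PiE (insert l v) G" by (auto simp: G_def PiE_iff)
    qed
    then have "(\<Sum>k\<in>F. w (insert l v) k * c k) \<le> (\<Sum>k\<in>PiE (insert l v) G. w (insert l v) k * c k)"
      using assms G w0 by (intro sum_mono2 finite_PiE mult_nonneg_nonneg) (auto simp: c_def)
    also have "\<dots> = (\<Sum>g\<in>PiE v G. \<Sum>m\<in>G l. w (insert l v) (g(l := m)) * c (g(l := m)))"
      using assms by (rule_tac sum_PiE_insert)
    also have "\<dots> = (\<Sum>g\<in>PiE v G. w v g * (\<Sum>m\<in>G l. \<bar>real_of_int m\<bar> powr (-t) *
        real (card {x\<in>totatives N. [m * int x + (\<Sum>j\<in>v. g j * int (z j)) = 0] (mod int N)})))"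
    proof (intro sum.cong refl, unfold sum_distrib_left, intro sum.cong refl)
      fix g m assume gm: "g \<in> PiE v G" "m \<in> G l"
      have 1: "w (insert l v) (g(l := m)) = w v g * \<bar>real_of_int m\<bar> powr (-t)"
        using assms by (auto simp: w_def intro!: prod.cong)
      have "g(l := m) \<in> ?A"
        using gm G0 by (auto simp: PiE_iff extensional_def)
      moreover have "(\<Sum>j\<in>v. (g(l := m)) j * int ((z(l := x)) j)) = (\<Sum>j\<in>v. g j * int (z j))" for x
        using assms by (intro sum.cong) auto
      ultimately have "g(l := m) \<in> D x \<longleftrightarrow> [m * int x + (\<Sum>j\<in>v. g j * int (z j)) = 0] (mod int N)" for x
        using assms by (simp add: D_def dual_lattice_def del: fun_upd_apply) (simp add: fun_upd_same)
      then show "w (insert l v) (g(l := m)) * c (g(l := m)) = w v g * (\<bar>real_of_int m\<bar> powr (-t) *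
        real (card {x\<in>totatives N. [m * int x + (\<Sum>j\<in>v. g j * int (z j)) = 0] (mod int N)}))"
        by (simp add: 1 c_def)
    qed
    also have "\<dots> \<le> (\<Sum>g\<in>PiE v G. w v g * (2 * zeta t))"
      using assms G G0 w0 by (intro sum_mono mult_left_mono sum_units_congruence_le) auto
    also have "\<dots> = (\<Sum>g\<in>PiE v G. w v g) * (2 * zeta t)" by (simp add: sum_distrib_right)
    also have "\<dots> \<le> (2 * zeta t) ^ card v * (2 * zeta t)"
      unfolding w_def using assms G G0 zeta_nonneg[of t]
      by (intro mult_right_mono sum_prod_powr_le_zeta_power finite_PiE PiE_mono) auto
    finally show "(\<Sum>k\<in>F. w (insert l v) k * c k) \<le> (2 * zeta t) ^ card (insert l v)"
      using assms by (simp add: mult.commute)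
  qed
  then show ?thesis using S by (simp add: dual_sum_def w_def D_def)
qed

lemma coord_sets_Suc:
  "coord_sets (Suc l) = coord_sets l \<union> insert (Suc l) ` Pow {1..l}" (is "?L = ?R")
proof (intro equalityI subsetI)
  fix u assume "u \<in> ?L"
  then have u: "u \<noteq> {}" "u \<subseteq> insert (Suc l) {1..l}"
    by (auto simp: coord_sets_def atLeastAtMostSuc_conv)
  show "u \<in> ?R"
  proof (cases "Suc l \<in> u")
    case True
    then have "u = insert (Suc l) (u - {Suc l})" "u - {Suc l} \<in> Pow {1..l}"
      using u by blast+
    then show ?thesis by blast
  next
    case False
    then have "u \<subseteq> {1..l}" using u by blast
    then show ?thesis using u by (simp add: coord_sets_def)
  qed
next
  fix u assume "u \<in> ?R"
  then show "u \<in> ?L"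
    by (auto simp: coord_sets_def atLeastAtMostSuc_conv)
qed

lemma sum_coord_sets_Suc:
  fixes f :: "nat set \<Rightarrow> 'a::comm_monoid_add"
  shows "(\<Sum>u\<in>coord_sets (Suc l). f u) = (\<Sum>u\<in>coord_sets l. f u) + (\<Sum>v\<in>Pow {1..l}. f (insert (Suc l) v))"
proof -
  have "(\<Sum>u\<in>coord_sets (Suc l). f u) = (\<Sum>u\<in>coord_sets l. f u) + (\<Sum>u\<in>insert (Suc l) ` Pow {1..l}. f u)"
    unfolding coord_sets_Suc
    by (intro sum.union_disjoint finite_coord_sets) (auto simp: coord_sets_def)
  also have "(\<Sum>u\<in>insert (Suc l) ` Pow {1..l}. f u) = (\<Sum>v\<in>Pow {1..l}. f (insert (Suc l) v))"
  proof (rule sum.reindex_cong[OF _ refl refl], rule inj_onI)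
    fix v w assume "v \<in> Pow {1..l}" "w \<in> Pow {1..l}" "insert (Suc l) v = insert (Suc l) w"
    moreover from this have "Suc l \<notin> v" "Suc l \<notin> w" by auto
    ultimately show "v = w" by (simp add: insert_ident)
  qed
  finally show ?thesis .
qed

text \<open>The sets containing the newest coordinate contribute \<open>T\<close>, the only part of
  the criterion that the newest component affects. Minimizing the criterion thus minimizes
  \<open>T\<close>, and subadditivity of the power adds the estimate of \<open>T\<close> to the
  induction hypothesis.\<close>

lemma cbc_P_criterion_bound:
  assumes \<alpha>: "\<alpha> > 1 / 2" and lam: "1 / (2 * \<alpha>) < lam" "lam \<le> 1"
    and w: "weights \<gamma>" and N: "N \<ge> 2" and z: "cbc_output \<alpha> \<gamma> N s z"
  shows "P_criterion \<alpha> \<gamma> N s z powr lam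
    \<le> 1 / real (totient N) * (\<Sum>u\<in>coord_sets s. \<gamma> u powr lam * (2 * zeta (2 * \<alpha> * lam)) ^ card u)"
  using z
proof (induction s)
  case 0
  then show ?case by (simp add: P_criterion_eq coord_sets_def)
next
  case (Suc l)
  have lam0: "lam > 0" using \<alpha> lam by (smt (verit) divide_pos_pos)
  have t: "2 * \<alpha> * lam > 1" using \<alpha> lam by (simp add: field_simps)
  have \<gamma>0: "\<gamma> u \<ge> 0" if "u \<in> coord_sets r" for u r
    using w coord_sets_weight_index[OF that] by (auto simp: weights_def)
  have ins: "insert (Suc l) v \<in> coord_sets (Suc l)" if "v \<in> Pow {1..l}" for v
    using that by (auto simp: coord_sets_Suc)
  define T where "T = (\<lambda>z. \<Sum>v\<in>Pow {1..l}. \<gamma> (insert (Suc l) v) * dual_sum (2 * \<alpha>) N z (insert (Suc l) v))"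
  define Z where "Z = (\<Sum>v\<in>Pow {1..l}. \<gamma> (insert (Suc l) v) powr lam * (2 * zeta (2 * \<alpha> * lam)) ^ card (insert (Suc l) v))"
  have PT: "P_criterion \<alpha> \<gamma> N (Suc l) y = P_criterion \<alpha> \<gamma> N l y + T y" for y
    by (simp add: P_criterion_eq sum_coord_sets_Suc T_def)
  have T0: "T y \<ge> 0" for y
    unfolding T_def using ins by (intro sum_nonneg mult_nonneg_nonneg dual_sum_nonneg \<gamma>0) auto
  have min: "T z \<le> T (z(Suc l := x))" if x: "x \<in> totatives N" for x
  proof (cases "l = 0")
    case True
    \<comment> \<open>The first component is prescribed instead of minimized. Multiplication by a
      unit x does not affect divisibility by N, so 1 does exactly as well as every unit.\<close>
    have z1: "z (Suc 0) = 1" using Suc.prems by (simp add: cbc_output_def)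
    have "[m * int x = 0] (mod int N) \<longleftrightarrow> [m = 0] (mod int N)" for m :: int
      using x by (auto simp: cong_0_iff in_totatives_iff coprime_dvd_mult_left_iff coprime_commute)
    then have "dual_lattice N z {Suc 0} = dual_lattice N (z(Suc 0 := x)) {Suc 0}"
      using z1 by (simp add: dual_lattice_def)
    then show ?thesis using True by (simp add: T_def dual_sum_def)
  next
    case False
    have "x \<in> {1..N - 1}" using x N totatives_less[of x N] by (auto simp: in_totatives_iff)
    then have "P_criterion \<alpha> \<gamma> N (l + 1) z \<le> P_criterion \<alpha> \<gamma> N (l + 1) (z(l + 1 := x))"
      using Suc.prems False by (auto simp: cbc_output_def is_arg_min_def not_less)
    moreover have "P_criterion \<alpha> \<gamma> N l (z(Suc l := x)) = P_criterion \<alpha> \<gamma> N l z"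
      unfolding P_criterion_eq dual_sum_def
    proof (intro sum.cong refl)
      fix u assume "u \<in> coord_sets l"
      then have "dual_lattice N (z(Suc l := x)) u = dual_lattice N z u"
        by (intro dual_lattice_cong) (auto simp: coord_sets_def)
      then show "\<gamma> u * (\<Sum>\<^sub>\<infinity>k\<in>dual_lattice N (z(Suc l := x)) u. \<Prod>j\<in>u. \<bar>real_of_int (k j)\<bar> powr - (2 * \<alpha>)) =
         \<gamma> u * (\<Sum>\<^sub>\<infinity>k\<in>dual_lattice N z u. \<Prod>j\<in>u. \<bar>real_of_int (k j)\<bar> powr - (2 * \<alpha>))" by simp
    qed
    ultimately show ?thesis by (simp add: PT)
  qed
  \<comment> \<open>The mean over units, multiplied by their number to avoid the division.\<close>
  have "real (totient N) * T z powr lam = (\<Sum>x\<in>totatives N. T z powr lam)"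
    by (simp add: totient_def)
  also have "\<dots> \<le> (\<Sum>x\<in>totatives N. T (z(Suc l := x)) powr lam)"
    using min T0 lam0 by (intro sum_mono powr_mono2) auto
  also have "\<dots> \<le> (\<Sum>x\<in>totatives N. \<Sum>v\<in>Pow {1..l}. \<gamma> (insert (Suc l) v) powr lam *
      dual_sum (2 * \<alpha> * lam) N (z(Suc l := x)) (insert (Suc l) v))"
  proof (intro sum_mono)
    fix x
    have "T (z(Suc l := x)) powr lam \<le> (\<Sum>v\<in>Pow {1..l}.
        (\<gamma> (insert (Suc l) v) * dual_sum (2 * \<alpha>) N (z(Suc l := x)) (insert (Suc l) v)) powr lam)"
      unfolding T_def using lam lam0 ins
      by (intro sum_powr_le_powr_sum mult_nonneg_nonneg dual_sum_nonneg \<gamma>0) auto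
    also have "\<dots> \<le> (\<Sum>v\<in>Pow {1..l}. \<gamma> (insert (Suc l) v) powr lam *
      dual_sum (2 * \<alpha> * lam) N (z(Suc l := x)) (insert (Suc l) v))"
    proof (rule sum_mono)
      fix v assume v: "v \<in> Pow {1..l}"
      then have "finite (insert (Suc l) v)" by (auto intro: finite_subset)
      then show "(\<gamma> (insert (Suc l) v) * dual_sum (2 * \<alpha>) N (z(Suc l := x)) (insert (Suc l) v)) powr lam
          \<le> \<gamma> (insert (Suc l) v) powr lam * dual_sum (2 * \<alpha> * lam) N (z(Suc l := x)) (insert (Suc l) v)"
        using dual_sum_powr_le[of "insert (Suc l) v" lam "2 * \<alpha>" N "z(Suc l := x)"] lam lam0 t
          \<gamma>0[OF ins[OF v]] by (simp add: powr_mult dual_sum_nonneg mult_left_mono)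
    qed
    finally show "T (z(Suc l := x)) powr lam \<le> \<dots>" .
  qed
  also have "\<dots> = (\<Sum>v\<in>Pow {1..l}. \<gamma> (insert (Suc l) v) powr lam *
      (\<Sum>x\<in>totatives N. dual_sum (2 * \<alpha> * lam) N (z(Suc l := x)) (insert (Suc l) v)))"
    by (subst sum.swap) (simp add: sum_distrib_left)
  also have "\<dots> \<le> Z"
    unfolding Z_def
  proof (intro sum_mono mult_left_mono)
    fix v assume "v \<in> Pow {1..l}"
    then show "(\<Sum>x\<in>totatives N. dual_sum (2 * \<alpha> * lam) N (z(Suc l := x)) (insert (Suc l) v))
        \<le> (2 * zeta (2 * \<alpha> * lam)) ^ card (insert (Suc l) v)"
      using t N by (intro sum_units_dual_sum_le) (auto intro: finite_subset)
  qed auto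
  finally have TZ: "T z powr lam \<le> 1 / real (totient N) * Z"
    using N by (simp add: field_simps)
  have "cbc_output \<alpha> \<gamma> N l z" using Suc.prems by (auto simp: cbc_output_def)
  note IH = Suc.IH[OF this]
  have "P_criterion \<alpha> \<gamma> N (Suc l) z powr lam \<le> P_criterion \<alpha> \<gamma> N l z powr lam + T z powr lam"
    unfolding PT using lam lam0 T0
    by (intro powr_add_le_add_powr)
       (auto simp: P_criterion_eq intro!: sum_nonneg mult_nonneg_nonneg dual_sum_nonneg \<gamma>0)
  also have "\<dots> \<le> 1 / real (totient N) * (\<Sum>u\<in>coord_sets l. \<gamma> u powr lam * (2 * zeta (2 * \<alpha> * lam)) ^ card u)
      + 1 / real (totient N) * Z"
    using IH TZ by simp
  also have "\<dots> = 1 / real (totient N) * (\<Sum>u\<in>coord_sets (Suc l). \<gamma> u powr lam * (2 * zeta (2 * \<alpha> * lam)) ^ card u)"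
    by (simp add: sum_coord_sets_Suc Z_def distrib_left)
  finally show ?case .
qed

subsection \<open>Finite Fourier analysis on the integers modulo N\<close>

definition chi :: "nat \<Rightarrow> int \<Rightarrow> complex" where
  "chi N a = cis (2 * pi * real_of_int a / real N)"

text \<open>Residues of least absolute value; for even N the residue N/2 is represented by its
  positive value. As an image of \<open>{..<N}\<close>, the set turns character sums into geometric
  sums.\<close>

definition residues_sym :: "nat \<Rightarrow> int set" where
  "residues_sym N = (\<lambda>i. int i - int ((N - 1) div 2)) ` {..<N}"

text \<open>A bound for the k-th Fourier coefficient of the indicator of an initial segment of
  residues, whatever the length of the segment.\<close>

definition fourier_weight :: "int \<Rightarrow> real" where
  "fourier_weight k = (if k = 0 then 1 else 1 / (2 * \<bar>real_of_int k\<bar>))"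

lemma finite_residues_sym: "finite (residues_sym N)"
  by (simp add: residues_sym_def)

lemma zero_in_residues_sym: "N > 0 \<Longrightarrow> 0 \<in> residues_sym N"
  by (auto simp: residues_sym_def intro!: image_eqI[of _ _ "(N - 1) div 2"])

lemma residues_sym_abs_le: "k \<in> residues_sym N \<Longrightarrow> 2 * \<bar>k\<bar> \<le> int N"
proof -
  assume "k \<in> residues_sym N"
  then obtain i where i: "i < N" "k = int i - int ((N - 1) div 2)"
    by (auto simp: residues_sym_def)
  then have "2 * ((N - 1) div 2) \<le> N" "2 * i \<le> N + 2 * ((N - 1) div 2)" by linarith+
  then show ?thesis using i by (simp add: abs_if)
qed

lemma chi_add: "chi N (a + b) = chi N a * chi N b"
  by (simp add: chi_def cis_mult add_divide_distrib distrib_left)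

lemma chi_0 [simp]: "chi N 0 = 1"
  by (simp add: chi_def)

lemma norm_chi [simp]: "norm (chi N a) = 1"
  by (simp add: chi_def)

lemma chi_eq_1_iff: "N > 0 \<Longrightarrow> chi N a = 1 \<longleftrightarrow> int N dvd a"
proof -
  assume N: "N > 0"
  have "chi N a = 1 \<longleftrightarrow> (\<exists>n. 2 * pi * real_of_int a / real N = real_of_int n * (2 * pi))"
    unfolding chi_def cis_eq_1_iff ..
  also have "\<dots> \<longleftrightarrow> (\<exists>n. real_of_int a = real_of_int (n * int N))"
    using N by (simp add: field_simps)
  also have "\<dots> \<longleftrightarrow> (\<exists>n. a = n * int N)" by (simp only: of_int_eq_iff)
  finally show ?thesis by (auto simp: dvd_def mult.commute)
qed

lemma chi_mult_nat: "chi N (a * int n) = chi N a ^ n"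
  by (simp add: chi_def Complex.DeMoivre mult_ac)

lemma chi_sum: "finite A \<Longrightarrow> chi N (\<Sum>j\<in>A. f j) = (\<Prod>j\<in>A. chi N (f j))"
  by (induction A rule: finite_induct) (simp_all add: chi_add)

text \<open>Orthogonality of characters: the ratio of this geometric sum is an N-th root of
  unity.\<close>

lemma sum_chi_lessThan:
  assumes "N > 0"
  shows "(\<Sum>n<N. chi N (a * int n)) = of_nat N * of_bool (int N dvd a)"
proof (cases "int N dvd a")
  case True
  then show ?thesis using assms chi_eq_1_iff[of N a] by (simp add: chi_mult_nat)
next
  case False
  have "chi N a ^ N = 1" using assms chi_eq_1_iff[of N "a * int N"] by (simp add: chi_mult_nat)
  then show ?thesis using False assms chi_eq_1_iff[of N a] by (simp add: chi_mult_nat sum_gp_strict)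
qed

lemma sum_chi_residues_sym:
  assumes "N > 0"
  shows "(\<Sum>k\<in>residues_sym N. chi N (k * a)) = of_nat N * of_bool (int N dvd a)"
proof -
  define h where "h = int ((N - 1) div 2)"
  have "(\<Sum>k\<in>residues_sym N. chi N (k * a)) = (\<Sum>i<N. chi N ((int i - h) * a))"
    unfolding residues_sym_def h_def by (subst sum.reindex) (auto intro!: inj_onI)
  also have "\<dots> = (\<Sum>i<N. chi N (- h * a) * chi N (a * int i))"
    by (simp add: chi_add[symmetric] algebra_simps)
  also have "\<dots> = chi N (- h * a) * (of_nat N * of_bool (int N dvd a))"
    by (simp add: sum_chi_lessThan[OF assms] sum_distrib_left[symmetric])
  also have "\<dots> = of_nat N * of_bool (int N dvd a)"
    using chi_eq_1_iff[OF assms, of "- h * a"] by auto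
  finally show ?thesis .
qed

text \<open>Jordan's inequality: the concave sine lies above its chord on [0, pi/2].\<close>

lemma two_pi_le_sin:
  fixes x :: real
  assumes "0 \<le> x" "x \<le> 1 / 2"
  shows "2 * x \<le> sin (pi * x)"
proof -
  have "concave_on {0..pi/2} sin"
    by (rule f''_le0_imp_concave[where f' = cos and f'' = "\<lambda>x. - sin x"])
       (auto intro!: derivative_eq_intros sin_ge_zero)
  from concave_onD[OF this, of "2 * x" 0 "pi / 2"] show ?thesis
    using assms by (simp add: mult.commute)
qed

lemma norm_chi_diff_1: "norm (chi N a - 1) = 2 * \<bar>sin (pi * real_of_int a / real N)\<bar>"
  using dist_exp_i_1[of "2 * pi * real_of_int a / real N"] by (simp add: chi_def cis_conv_exp)

text \<open>The discrete Fourier coefficient of the indicator of \<open>{..<m}\<close> modulo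
  N.\<close>

definition fourier_coeff :: "nat \<Rightarrow> nat \<Rightarrow> int \<Rightarrow> complex" where
  "fourier_coeff N m k = 1 / of_nat N * (\<Sum>r<m. chi N (- k * int r))"

lemma fourier_coeff_0: "fourier_coeff N m 0 = of_nat m / of_nat N"
  by (simp add: fourier_coeff_def)

text \<open>A geometric sum with ratio y \<noteq> 1 has norm at most 2 / |1 - y|, and |1 - y| = 2
  |sin(pi k / N)| \<ge> 4 |k| / N by Jordan's inequality, which needs |k| \<le> N/2.\<close>

lemma norm_fourier_coeff_le:
  assumes "N > 0" "m \<le> N" "k \<in> residues_sym N"
  shows "norm (fourier_coeff N m k) \<le> fourier_weight k"
proof (cases "k = 0")
  case True
  then show ?thesis using assms by (simp add: fourier_coeff_0 fourier_weight_def norm_divide)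
next
  case False
  have k: "2 * \<bar>k\<bar> \<le> int N" using assms by (intro residues_sym_abs_le)
  define y where "y = chi N (- k)"
  have "2 * \<bar>real_of_int k\<bar> / real N \<le> \<bar>sin (pi * real_of_int k / real N)\<bar>"
  proof -
    have "2 * (\<bar>real_of_int k\<bar> / real N) \<le> sin (pi * (\<bar>real_of_int k\<bar> / real N))"
      using k assms by (intro two_pi_le_sin) (auto simp: field_simps)
    also have "\<dots> \<le> \<bar>sin (pi * real_of_int k / real N)\<bar>"
      by (cases "k \<ge> 0") auto
    finally show ?thesis by simp
  qed
  then have lb: "4 * \<bar>real_of_int k\<bar> / real N \<le> norm (1 - y)"
    using norm_chi_diff_1[of N "- k"] by (simp add: y_def norm_minus_commute)
  have pos: "4 * \<bar>real_of_int k\<bar> / real N > 0" using False assms by simp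
  then have y1: "y \<noteq> 1" using lb by auto
  have "norm (\<Sum>r<m. chi N (- k * int r)) = norm (1 - y ^ m) / norm (1 - y)"
    using y1 by (simp add: chi_mult_nat y_def sum_gp_strict norm_divide del: mult_minus_left)
  also have "\<dots> \<le> 2 / norm (1 - y)"
    using norm_triangle_ineq4[of 1 "y ^ m"] by (intro divide_right_mono) (auto simp: y_def norm_power)
  also have "\<dots> \<le> 2 / (4 * \<bar>real_of_int k\<bar> / real N)"
    using lb pos by (intro divide_left_mono mult_pos_pos) auto
  finally have "norm (fourier_coeff N m k) \<le> 1 / real N * (2 / (4 * \<bar>real_of_int k\<bar> / real N))"
    unfolding fourier_coeff_def norm_mult using assms
    by (intro mult_mono) (auto simp: norm_divide)
  also have "\<dots> = fourier_weight k" using False assms by (simp add: fourier_weight_def field_simps)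
  finally show ?thesis .
qed

lemma fourier_inversion:
  assumes "N > 0" "m \<le> N"
  shows "of_bool (a mod N < m) = (\<Sum>k\<in>residues_sym N. fourier_coeff N m k * chi N (k * int a))"
proof -
  have "(\<Sum>k\<in>residues_sym N. fourier_coeff N m k * chi N (k * int a))
      = (\<Sum>k\<in>residues_sym N. \<Sum>r<m. 1 / of_nat N * chi N (k * (int a - int r)))"
    by (simp add: fourier_coeff_def sum_distrib_left sum_distrib_right chi_add[symmetric] algebra_simps)
  also have "\<dots> = (\<Sum>r<m. 1 / of_nat N * (\<Sum>k\<in>residues_sym N. chi N (k * (int a - int r))))"
    by (subst sum.swap) (simp add: sum_distrib_left)
  also have "\<dots> = (\<Sum>r<m. of_bool (int N dvd int a - int r))"
    using assms by (simp add: sum_chi_residues_sym)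
  also have "\<dots> = (\<Sum>r<m. of_bool (r = a mod N))"
  proof (rule sum.cong[OF refl])
    fix r assume "r \<in> {..<m}"
    \<comment> \<open>Orthogonality sees only residues; \<open>m \<le> N\<close> makes every r < m
      its own residue.\<close>
    then have "r mod N = r" using assms by auto
    have "int N dvd int a - int r \<longleftrightarrow> a mod N = r mod N"
      by (simp flip: mod_eq_dvd_iff of_nat_mod)
    then show "of_bool (int N dvd int a - int r) = of_bool (r = a mod N)"
      using \<open>r mod N = r\<close> by auto
  qed
  also have "\<dots> = of_bool (a mod N < m)"
    by (simp add: of_bool_def)
  finally show ?thesis by simp
qed

text \<open>Each indicator is expanded in characters, and summation over n leaves only the frequency
  vectors in the dual lattice. The zero vector contributes exactly the volume of the box, so the
  error consists of the others. Side lengths in multiples of 1/N make the indicators functions of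
  residues.\<close>

lemma lattice_count_bound:
  fixes z m :: "nat \<Rightarrow> nat"
  assumes "N > 0" "finite u" and m: "\<And>j. j \<in> u \<Longrightarrow> m j \<le> N"
  defines "L \<equiv> {k \<in> (\<Pi>\<^sub>E j\<in>u. residues_sym N). int N dvd (\<Sum>j\<in>u. k j * int (z j))}"
  shows "\<bar>1 / real N * (\<Sum>n<N. \<Prod>j\<in>u. of_bool (n * z j mod N < m j)) - (\<Prod>j\<in>u. real (m j) / real N)\<bar>
    \<le> (\<Sum>k\<in>L - {\<lambda>j\<in>u. 0}. \<Prod>j\<in>u. fourier_weight (k j))"
proof -
  let ?K = "\<Pi>\<^sub>E j\<in>u. residues_sym N"
  define c where "c = (\<lambda>k. \<Prod>j\<in>u. fourier_coeff N (m j) (k j))"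
  have finK: "finite ?K" using assms by (intro finite_PiE finite_residues_sym)
  then have finL: "finite L" unfolding L_def by auto
  have zL: "(\<lambda>j\<in>u. 0) \<in> L"
    using assms zero_in_residues_sym[of N] by (simp add: L_def)
  have "(\<Prod>j\<in>u. of_bool (n * z j mod N < m j)) = (\<Sum>k\<in>?K. c k * chi N ((\<Sum>j\<in>u. k j * int (z j)) * int n))" for n
  proof -
    have "(\<Prod>j\<in>u. of_bool (n * z j mod N < m j))
        = (\<Prod>j\<in>u. \<Sum>k\<in>residues_sym N. fourier_coeff N (m j) k * chi N (k * int (n * z j)))"
      using m assms(1) by (intro prod.cong refl fourier_inversion) auto
    also have "\<dots> = (\<Sum>k\<in>?K. \<Prod>j\<in>u. fourier_coeff N (m j) (k j) * chi N (k j * int (n * z j)))"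
      using assms finite_residues_sym by (intro prod_sum_PiE) auto
    also have "\<dots> = (\<Sum>k\<in>?K. c k * chi N ((\<Sum>j\<in>u. k j * int (z j)) * int n))"
      using assms(2) by (simp add: c_def prod.distrib chi_sum[symmetric] sum_distrib_left mult_ac)
    finally show ?thesis .
  qed
  then have "1 / of_nat N * (\<Sum>n<N. \<Prod>j\<in>u. of_bool (n * z j mod N < m j))
      = 1 / of_nat N * (\<Sum>n<N. \<Sum>k\<in>?K. c k * chi N ((\<Sum>j\<in>u. k j * int (z j)) * int n))"
    by simp
  also have "\<dots> = 1 / of_nat N * (\<Sum>k\<in>?K. c k * (\<Sum>n<N. chi N ((\<Sum>j\<in>u. k j * int (z j)) * int n)))"
    by (subst sum.swap) (simp add: sum_distrib_left)
  also have "\<dots> = (\<Sum>k\<in>?K. c k * of_bool (int N dvd (\<Sum>j\<in>u. k j * int (z j))))"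
    unfolding sum_chi_lessThan[OF assms(1)] using assms(1) by (simp add: sum_distrib_left)
  also have "\<dots> = (\<Sum>k\<in>L. c k)"
    using finK by (intro sum.mono_neutral_cong_right) (auto simp: L_def)
  also have "\<dots> = c (\<lambda>j\<in>u. 0) + (\<Sum>k\<in>L - {\<lambda>j\<in>u. 0}. c k)"
    using finL zL by (rule sum.remove)
  also have "c (\<lambda>j\<in>u. 0) = (\<Prod>j\<in>u. of_nat (m j) / of_nat N)"
    by (simp add: c_def fourier_coeff_0)
  finally have "1 / of_nat N * (\<Sum>n<N. \<Prod>j\<in>u. of_bool (n * z j mod N < m j))
      - (\<Prod>j\<in>u. of_nat (m j) / of_nat N) = (\<Sum>k\<in>L - {\<lambda>j\<in>u. 0}. c k)"
    by (simp only: add_diff_cancel_left')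
  moreover have "complex_of_real (of_bool b) = of_bool b" for b by simp
  ultimately have "complex_of_real (1 / real N * (\<Sum>n<N. \<Prod>j\<in>u. of_bool (n * z j mod N < m j)) - (\<Prod>j\<in>u. real (m j) / real N))
      = (\<Sum>k\<in>L - {\<lambda>j\<in>u. 0}. c k)"
    by (simp only: of_real_diff of_real_mult of_real_sum of_real_prod of_real_divide of_real_of_nat_eq of_real_1)
  from arg_cong[OF this, of norm] have "\<bar>1 / real N * (\<Sum>n<N. \<Prod>j\<in>u. of_bool (n * z j mod N < m j)) - (\<Prod>j\<in>u. real (m j) / real N)\<bar>
      = norm (\<Sum>k\<in>L - {\<lambda>j\<in>u. 0}. c k)"
    by (simp only: norm_of_real)
  also have "\<dots> \<le> (\<Sum>k\<in>L - {\<lambda>j\<in>u. 0}. \<Prod>j\<in>u. fourier_weight (k j))"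
  proof (rule sum_norm_le)
    fix k assume k: "k \<in> L - {\<lambda>j\<in>u. 0}"
    show "norm (c k) \<le> (\<Prod>j\<in>u. fourier_weight (k j))"
      unfolding c_def prod_norm[symmetric]
    proof (rule prod_mono, rule conjI)
      fix j assume "j \<in> u"
      then show "norm (fourier_coeff N (m j) (k j)) \<le> fourier_weight (k j)"
        using k m assms(1) by (intro norm_fourier_coeff_le) (auto simp: L_def)
    qed simp
  qed
  finally show ?thesis .
qed

subsection \<open>Dyadic decomposition of the dual lattice sum\<close>

text \<open>Greedy distribution of B over places of capacity \<open>a j\<close>; in the packing
  argument it shares the total cell exponent among the coordinates.\<close>

lemma exists_sum_eq_le:
  fixes a :: "'a \<Rightarrow> nat"
  assumes "finite u" "B \<le> (\<Sum>j\<in>u. a j)"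
  shows "\<exists>b. (\<forall>j\<in>u. b j \<le> a j) \<and> (\<Sum>j\<in>u. b j) = B"
  using assms
proof (induction u arbitrary: B rule: finite_induct)
  case (insert i u)
  have "B - min B (a i) \<le> (\<Sum>j\<in>u. a j)" using insert by auto
  then obtain b where b: "\<forall>j\<in>u. b j \<le> a j" "(\<Sum>j\<in>u. b j) = B - min B (a i)"
    using insert.IH by blast
  have "(\<Sum>j\<in>u. (b(i := min B (a i))) j) = (\<Sum>j\<in>u. b j)"
    using insert.hyps by (intro sum.cong) auto
  then show ?case using b insert.hyps by (intro exI[of _ "b(i := min B (a i))"]) auto
qed auto

text \<open>Sign times bit length: class c \<noteq> 0 consists of the integers with the sign of c
  and 2^(|c|-1) \<le> |k| < 2^|c|. The sign is kept so that distances within a class can be read off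
  from absolute values.\<close>

definition dyadic_class :: "int \<Rightarrow> int" where
  "dyadic_class k = sgn k * (if k = 0 then 0 else int (floorlog 2 (nat \<bar>k\<bar>)))"

lemma dyadic_class_bounds:
  assumes "k \<noteq> 0"
  shows "nat \<bar>dyadic_class k\<bar> > 0" "2 ^ (nat \<bar>dyadic_class k\<bar> - 1) \<le> \<bar>k\<bar>" "\<bar>k\<bar> < 2 ^ nat \<bar>dyadic_class k\<bar>"
    "sgn (dyadic_class k) = sgn k"
proof -
  have p: "floorlog 2 (nat \<bar>k\<bar>) > 0" using assms by (simp add: floorlog_def)
  have e: "nat \<bar>dyadic_class k\<bar> = floorlog 2 (nat \<bar>k\<bar>)"
    using assms by (simp add: dyadic_class_def abs_mult sgn_if)
  show "nat \<bar>dyadic_class k\<bar> > 0" using e p by simp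
  have "2 ^ (floorlog 2 (nat \<bar>k\<bar>) - 1) \<le> nat \<bar>k\<bar> \<and> nat \<bar>k\<bar> < 2 ^ floorlog 2 (nat \<bar>k\<bar>)"
    using assms floorlog_bounds[of "nat \<bar>k\<bar>" 2] by simp
  then show "2 ^ (nat \<bar>dyadic_class k\<bar> - 1) \<le> \<bar>k\<bar>" "\<bar>k\<bar> < 2 ^ nat \<bar>dyadic_class k\<bar>"
    unfolding e by (simp_all add: nat_less_iff le_nat_iff)
  show "sgn (dyadic_class k) = sgn k"
    using assms p by (simp add: dyadic_class_def sgn_mult)
qed

lemma dyadic_class_0 [simp]: "dyadic_class 0 = 0"
  by (simp add: dyadic_class_def)

text \<open>The factor 2 in the weight offsets the lower end 2^(|c|-1) of class c, so that no
  constant is lost in a coordinate.\<close>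

lemma fourier_weight_le_dyadic: "fourier_weight k \<le> 1 / 2 ^ nat \<bar>dyadic_class k\<bar>"
proof (cases "k = 0")
  case False
  note b = dyadic_class_bounds[OF False]
  have "2 ^ nat \<bar>dyadic_class k\<bar> = 2 * (2 :: int) ^ (nat \<bar>dyadic_class k\<bar> - 1)"
    using b(1) by (simp flip: power_Suc)
  also have "\<dots> \<le> 2 * \<bar>k\<bar>" using b(2) by simp
  finally have "real_of_int (2 ^ nat \<bar>dyadic_class k\<bar>) \<le> real_of_int (2 * \<bar>k\<bar>)"
    by (simp only: of_int_le_iff)
  then show ?thesis using False by (simp add: fourier_weight_def field_simps)
qed (simp add: fourier_weight_def)

lemma fourier_weight_nonneg: "fourier_weight k \<ge> 0"
  by (simp add: fourier_weight_def)

text \<open>Within a dyadic class, dividing coordinate j by 2^(b j) with b chosen so that the cells have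
  volume at most \<rho> separates the points of L, since the difference of two points of L in one cell
  would be a nonzero element of the lattice violating the bound \<rho>.\<close>

lemma dyadic_class_sum_le:
  fixes L :: "('a \<Rightarrow> int) set" and \<rho> :: real
  assumes "finite u" "finite L" "L \<subseteq> (\<Pi>\<^sub>E j\<in>u. UNIV)" "\<rho> \<ge> 1"
    and cl: "\<And>k j. k \<in> L \<Longrightarrow> j \<in> u \<Longrightarrow> dyadic_class (k j) = c j"
    and nz: "\<And>k. k \<in> L \<Longrightarrow> \<exists>j\<in>u. k j \<noteq> 0"
    and big: "\<And>k. k \<in> L \<Longrightarrow> \<rho> \<le> (\<Prod>j\<in>u. max 1 \<bar>real_of_int (k j)\<bar>)"
    and sep: "\<And>k k'. k \<in> L \<Longrightarrow> k' \<in> L \<Longrightarrow> k \<noteq> k' \<Longrightarrow> \<rho> \<le> (\<Prod>j\<in>u. max 1 \<bar>real_of_int (k j - k' j)\<bar>)"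
  shows "(\<Sum>k\<in>L. \<Prod>j\<in>u. fourier_weight (k j)) \<le> 1 / \<rho>"
proof (cases "L = {}")
  case False
  then obtain k0 where k0: "k0 \<in> L" by auto
  \<comment> \<open>Every term of the sum is at most 2^(-C), while 2^A is the number of integer
    vectors in the class. For a coordinate of class 0 the truncated subtraction gives
    \<open>a j = 0\<close>, in agreement with its single value 0.\<close>
  define C where "C = (\<Sum>j\<in>u. nat \<bar>c j\<bar>)"
  define a where "a = (\<lambda>j. nat \<bar>c j\<bar> - 1)"
  define A where "A = (\<Sum>j\<in>u. a j)"
  \<comment> \<open>Strict because some coordinate is nonzero. The factor 2 saved here pays at the
    end for rounding \<rho> down to a power of two.\<close>
  have "A < C"
  proof -
    obtain j where j: "j \<in> u" "k0 j \<noteq> 0" using nz[OF k0] by auto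
    then have "a j < nat \<bar>c j\<bar>" using dyadic_class_bounds(1)[OF j(2)] cl[OF k0 j(1)] by (simp add: a_def)
    then show ?thesis unfolding A_def C_def using assms(1) j
      by (intro sum_strict_mono_ex1) (auto simp: a_def)
  qed
  have rC: "\<rho> \<le> 2 ^ C"
  proof -
    have "\<rho> \<le> (\<Prod>j\<in>u. max 1 \<bar>real_of_int (k0 j)\<bar>)" by (rule big[OF k0])
    also have "\<dots> \<le> (\<Prod>j\<in>u. 2 ^ nat \<bar>c j\<bar>)"
    proof (rule prod_mono, safe)
      fix j assume j: "j \<in> u"
      show "max 1 \<bar>real_of_int (k0 j)\<bar> \<le> 2 ^ nat \<bar>c j\<bar>"
      proof (cases "k0 j = 0")
        case False
        have "real_of_int \<bar>k0 j\<bar> < real_of_int (2 ^ nat \<bar>c j\<bar>)"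
          using dyadic_class_bounds(3)[OF False] cl[OF k0 j] by (simp only: of_int_less_iff)
        then show ?thesis by simp
      qed simp
    qed auto
    also have "\<dots> = 2 ^ C" by (simp add: C_def power_sum)
    finally show ?thesis .
  qed
  \<comment> \<open>2^B is \<rho> rounded down to a power of two, but capped at 2^A because a cell
    need not exceed the class. At the cap a single cell remains and \<open>rC\<close> gives the
    bound; otherwise \<rho> < 2^(B+1).\<close>
  obtain B :: nat where B: "B \<le> A" "2 ^ B \<le> \<rho>" "B = A \<or> \<rho> < 2 ^ (B + 1)"
  proof (cases "2 ^ A \<le> \<rho>")
    case True
    then show ?thesis using that[of A] by simp
  next
    case False
    define P where "P = (\<lambda>n. \<rho> < 2 ^ n)"
    have "P A" using False by (simp add: P_def)
    define n where "n = (LEAST n. P n)"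
    have n: "P n" "n \<le> A" unfolding n_def using \<open>P A\<close> by (auto intro: LeastI Least_le)
    have "n > 0" using n(1) assms(4) by (cases n) (auto simp: P_def)
    then have "\<not> P (n - 1)" unfolding n_def by (intro not_less_Least) simp
    then show ?thesis using that[of "n - 1"] n \<open>n > 0\<close> by (simp add: P_def)
  qed
  obtain b where b: "\<forall>j\<in>u. b j \<le> a j" "(\<Sum>j\<in>u. b j) = B"
    using exists_sum_eq_le[of u B a] B(1) assms(1) by (auto simp: A_def)
  define cell where "cell = (\<lambda>k :: 'a \<Rightarrow> int. \<lambda>j\<in>u. \<bar>k j\<bar> div 2 ^ b j)"
  \<comment> \<open>The possible cell indices in coordinate j. Since \<open>b j \<le> a j\<close>,
    the cells divide the class evenly into 2^(a j - b j) pieces.\<close>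
  define R where "R = (\<lambda>j. if c j = 0 then {0 :: int} else {2 ^ (a j - b j)..<2 ^ (Suc (a j) - b j)})"
  have cardR: "finite (R j) \<and> card (R j) = 2 ^ (a j - b j)" if "j \<in> u" for j
  proof (cases "c j = 0")
    case False
    have "b j \<le> a j" using b that by auto
    then show ?thesis using False by (simp add: R_def Suc_diff_le nat_power_eq)
  next
    case True
    then show ?thesis by (simp add: R_def a_def)
  qed
  have "inj_on cell L"
  proof (rule inj_onI, rule ccontr)
    fix k k' assume kk: "k \<in> L" "k' \<in> L" "cell k = cell k'" "k \<noteq> k'"
    have d: "max 1 \<bar>real_of_int (k j - k' j)\<bar> \<le> 2 ^ b j \<and> \<bar>real_of_int (k j - k' j)\<bar> < 2 ^ b j" if j: "j \<in> u" for j
    proof -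
      have q: "\<bar>k j\<bar> div 2 ^ b j = \<bar>k' j\<bar> div 2 ^ b j"
        using fun_cong[OF kk(3), of j] j by (simp add: cell_def)
      have "\<bar>\<bar>k j\<bar> - \<bar>k' j\<bar>\<bar> < 2 ^ b j"
      proof -
        have "\<bar>k j\<bar> = \<bar>k j\<bar> div 2 ^ b j * 2 ^ b j + \<bar>k j\<bar> mod 2 ^ b j"
             "\<bar>k' j\<bar> = \<bar>k j\<bar> div 2 ^ b j * 2 ^ b j + \<bar>k' j\<bar> mod 2 ^ b j"
          by (simp only: div_mult_mod_eq) (simp only: q div_mult_mod_eq)
        moreover have "0 \<le> \<bar>k j\<bar> mod 2 ^ b j" "\<bar>k j\<bar> mod 2 ^ b j < 2 ^ b j"
           "0 \<le> \<bar>k' j\<bar> mod 2 ^ b j" "\<bar>k' j\<bar> mod 2 ^ b j < 2 ^ b j" by simp_all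
        ultimately show ?thesis by linarith
      qed
      \<comment> \<open>A common class fixes the sign, so cells built from absolute values still
        bound the difference itself.\<close>
      moreover have "sgn (k j) = sgn (k' j)"
      proof (cases "k j = 0 \<or> k' j = 0")
        case True
        then have "c j = 0" using cl[OF kk(1) j] cl[OF kk(2) j] by auto
        then have "k j = 0" "k' j = 0"
          using dyadic_class_bounds(1)[of "k j"] dyadic_class_bounds(1)[of "k' j"] cl[OF kk(1) j] cl[OF kk(2) j]
          by auto
        then show ?thesis by simp
      next
        case False
        then show ?thesis
          using dyadic_class_bounds(4)[of "k j"] dyadic_class_bounds(4)[of "k' j"] cl[OF kk(1) j] cl[OF kk(2) j]
          by simp
      qed
      then have "\<bar>\<bar>k j\<bar> - \<bar>k' j\<bar>\<bar> = \<bar>k j - k' j\<bar>" by (auto simp: sgn_if split: if_splits)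
      ultimately have "\<bar>k j - k' j\<bar> < 2 ^ b j" by simp
      then have "real_of_int \<bar>k j - k' j\<bar> < real_of_int (2 ^ b j)" by (simp only: of_int_less_iff)
      then show ?thesis by simp
    qed
    obtain j where j: "j \<in> u" "k j \<noteq> k' j"
      using kk assms(3) by (metis PiE_ext subsetD)
    \<comment> \<open>If \<open>b j = 0\<close>, the maximum with 1 equals 2^(b j) on points that
      agree in coordinate j; strictness therefore comes from a coordinate in which the points
      differ.\<close>
    have lt: "max 1 \<bar>real_of_int (k j - k' j)\<bar> < 2 ^ b j"
    proof -
      have "1 \<le> \<bar>k j - k' j\<bar>" using j by simp
      then have "1 \<le> real_of_int \<bar>k j - k' j\<bar>" by (simp only: of_int_1_le_iff)
      then show ?thesis using d[OF j(1)] by (simp add: max_def)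
    qed
    have "(\<Prod>j\<in>u. max 1 \<bar>real_of_int (k j - k' j)\<bar>) < (\<Prod>j\<in>u. 2 ^ b j)"
    proof (rule prod_mono_strict[where i = j])
      fix j' assume "j' \<in> u"
      then show "0 \<le> max 1 \<bar>real_of_int (k j' - k' j')\<bar> \<and> max 1 \<bar>real_of_int (k j' - k' j')\<bar> \<le> 2 ^ b j'"
        using d by simp
    qed (use assms(1) j lt in auto)
    also have "\<dots> = 2 ^ B" unfolding b(2)[symmetric] by (simp add: power_sum)
    finally show False using sep[OF kk(1,2,4)] B(2) by simp
  qed
  moreover have "cell ` L \<subseteq> PiE u R"
  proof
    fix y assume "y \<in> cell ` L"
    then obtain k where k: "k \<in> L" "y = cell k" by auto
    have "\<bar>k j\<bar> div 2 ^ b j \<in> R j" if j: "j \<in> u" for j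
    proof (cases "c j = 0")
      case True
      then have "k j = 0" using dyadic_class_bounds(1)[of "k j"] cl[OF k(1) j] by auto
      then show ?thesis using True by (simp add: R_def)
    next
      case False
      then have kj: "k j \<noteq> 0" using cl[OF k(1) j] by auto
      have ba: "b j \<le> a j" using b j by auto
      have ca: "nat \<bar>c j\<bar> = Suc (a j)" using False by (simp add: a_def)
      have 1: "2 ^ a j \<le> \<bar>k j\<bar>" "\<bar>k j\<bar> < 2 ^ Suc (a j)"
        using dyadic_class_bounds(2,3)[OF kj] cl[OF k(1) j] ca by simp_all
      have e: "(2 :: int) ^ a j = 2 ^ (a j - b j) * 2 ^ b j" "(2 :: int) ^ Suc (a j) = 2 ^ (Suc (a j) - b j) * 2 ^ b j"
        using ba by (simp_all add: power_add[symmetric] del: power_Suc)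
      have "2 ^ (a j - b j) \<le> \<bar>k j\<bar> div 2 ^ b j"
        using zdiv_mono1[OF 1(1), of "2 ^ b j"] unfolding e(1) by simp
      moreover have "\<bar>k j\<bar> div 2 ^ b j < 2 ^ (Suc (a j) - b j)"
      proof (rule ccontr)
        assume "\<not> ?thesis"
        then have "2 ^ (Suc (a j) - b j) * 2 ^ b j \<le> \<bar>k j\<bar> div 2 ^ b j * 2 ^ b j"
          by (intro mult_right_mono) auto
        also have "\<dots> = \<bar>k j\<bar> - \<bar>k j\<bar> mod 2 ^ b j" by (rule minus_mod_eq_div_mult[symmetric])
        also have "\<dots> \<le> \<bar>k j\<bar>" by simp
        finally show False using 1(2) unfolding e(2) by simp
      qed
      ultimately show ?thesis using False by (simp add: R_def)
    qed
    then show "y \<in> PiE u R" using k by (simp add: cell_def)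
  qed
  ultimately have "card L \<le> card (PiE u R)"
    using assms(1) cardR by (intro card_inj_on_le finite_PiE) auto
  also have "card (PiE u R) = 2 ^ (A - B)"
  proof -
    have "card (PiE u R) = (\<Prod>j\<in>u. 2 ^ (a j - b j))"
      using assms(1) cardR by (simp add: card_PiE)
    also have "\<dots> = 2 ^ (\<Sum>j\<in>u. a j - b j)" by (simp add: power_sum)
    also have "(\<Sum>j\<in>u. a j - b j) = A - B"
      using b sum_subtractf_nat[of u b a] by (simp add: A_def)
    finally show ?thesis .
  qed
  finally have cardL: "card L \<le> 2 ^ (A - B)" .
  have "(\<Sum>k\<in>L. \<Prod>j\<in>u. fourier_weight (k j)) \<le> (\<Sum>k\<in>L. 1 / 2 ^ C)"
  proof (rule sum_mono)
    fix k assume k: "k \<in> L"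
    have "(\<Prod>j\<in>u. fourier_weight (k j)) \<le> (\<Prod>j\<in>u. 1 / 2 ^ nat \<bar>c j\<bar>)"
    proof (rule prod_mono, safe)
      fix j assume j: "j \<in> u"
      show "fourier_weight (k j) \<le> 1 / 2 ^ nat \<bar>c j\<bar>"
        using fourier_weight_le_dyadic[of "k j"] cl[OF k j] by simp
    qed (rule fourier_weight_nonneg)
    also have "\<dots> = 1 / 2 ^ C" by (simp add: C_def power_sum prod_dividef)
    finally show "(\<Prod>j\<in>u. fourier_weight (k j)) \<le> 1 / 2 ^ C" .
  qed
  also have "\<dots> = real (card L) / 2 ^ C" by simp
  also have "\<dots> \<le> 2 ^ (A - B) / 2 ^ C"
    using cardL by (intro divide_right_mono) (simp_all flip: of_nat_le_iff)
  also have "\<dots> \<le> 1 / \<rho>"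
    using B(3)
  proof
    assume "B = A"
    then show ?thesis using rC assms(4) by (simp add: field_simps)
  next
    assume r: "\<rho> < 2 ^ (B + 1)"
    have "2 ^ (A - B) * \<rho> \<le> 2 ^ (A - B) * 2 ^ (B + 1)" using r by (intro mult_left_mono) auto
    also have "\<dots> = (2 :: real) ^ (A + 1)" using B(1) by (simp add: power_add[symmetric])
    also have "\<dots> \<le> 2 ^ C" using \<open>A < C\<close> by (intro power_increasing) auto
    finally show ?thesis using assms(4) by (simp add: field_simps)
  qed
  finally show ?thesis .
qed (use assms in auto)

text \<open>The bound |k| \<le> N/2, and not merely |k| < N, keeps the bit length at most log_2 N. A
  coordinate thus meets at most 2 log_2 N + 1 signed classes.\<close>

lemma dyadic_class_residues_sym:
  assumes "k \<in> residues_sym N" "N > 0"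
  shows "dyadic_class k \<in> {-\<lfloor>log 2 N\<rfloor>..\<lfloor>log 2 N\<rfloor>}"
proof (cases "k = 0")
  case True
  then show ?thesis using assms by simp
next
  case False
  note b = dyadic_class_bounds[OF False]
  let ?n = "nat \<bar>dyadic_class k\<bar>"
  have "2 ^ ?n = 2 * (2 :: int) ^ (?n - 1)" using b(1) by (simp flip: power_Suc)
  also have "\<dots> \<le> 2 * \<bar>k\<bar>" using b(2) by simp
  also have "\<dots> \<le> int N" using assms by (intro residues_sym_abs_le)
  finally have "2 ^ ?n \<le> real N" by (simp flip: of_int_le_iff)
  then have "log 2 (2 ^ ?n) \<le> log 2 (real N)" using assms by (subst log_le_cancel_iff) auto
  then have "real ?n \<le> log 2 N" by (simp only: log_pow_cancel)
  then have "int ?n \<le> \<lfloor>log 2 N\<rfloor>" by (simp add: le_floor_iff)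
  then show ?thesis by auto
qed

text \<open>The hypothesis on \<rho> speaks of all integer vectors, not only of those with
  coordinates in \<open>residues_sym N\<close>, because the packing argument applies it to
  differences, which may leave that range.\<close>

lemma dual_lattice_sum_le:
  fixes z :: "nat \<Rightarrow> nat" and \<rho> :: real
  assumes "finite u" "N > 0"
    and \<rho>: "\<rho> > 0" "\<And>k. \<exists>j\<in>u. k j \<noteq> 0 \<Longrightarrow> int N dvd (\<Sum>j\<in>u. k j * int (z j))
      \<Longrightarrow> \<rho> \<le> (\<Prod>j\<in>u. max 1 \<bar>real_of_int (k j)\<bar>)"
  defines "L \<equiv> {k \<in> (\<Pi>\<^sub>E j\<in>u. residues_sym N). int N dvd (\<Sum>j\<in>u. k j * int (z j))}"
  shows "(\<Sum>k\<in>L - {\<lambda>j\<in>u. 0}. \<Prod>j\<in>u. fourier_weight (k j)) \<le> (2 * log 2 N + 1) ^ card u / \<rho>"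
proof -
  \<comment> \<open>Packing needs a bound of at least 1. The products are at least 1 anyway, so
    \<rho> may be raised to 1.\<close>
  define \<sigma> where "\<sigma> = max 1 \<rho>"
  define M where "M = \<lfloor>log 2 N\<rfloor>"
  define cl where "cl = (\<lambda>k. \<lambda>j\<in>u. dyadic_class (k j))"
  let ?L = "L - {\<lambda>j\<in>u. 0}"
  have M: "0 \<le> M" using assms(2) by (simp add: M_def)
  have finL: "finite ?L"
    using assms(1) finite_residues_sym by (auto simp: L_def intro!: finite_subset[OF _ finite_PiE[of u "\<lambda>_. residues_sym N"]])
  have \<sigma>: "\<sigma> \<le> (\<Prod>j\<in>u. max 1 \<bar>real_of_int (k j)\<bar>)"
    if "\<exists>j\<in>u. k j \<noteq> 0" "int N dvd (\<Sum>j\<in>u. k j * int (z j))" for k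
    using \<rho>(2)[OF that] by (auto simp: \<sigma>_def intro!: prod_ge_1)
  have nz: "\<exists>j\<in>u. k j \<noteq> 0" if "k \<in> ?L" for k
  proof (rule ccontr)
    assume "\<not> ?thesis"
    then have "k = (\<lambda>j\<in>u. 0)" using that by (auto simp: L_def PiE_iff extensional_def fun_eq_iff)
    then show False using that by auto
  qed
  have clM: "cl ` ?L \<subseteq> (\<Pi>\<^sub>E j\<in>u. {-M..M})"
    using assms(2) dyadic_class_residues_sym by (auto simp: cl_def L_def M_def PiE_iff)
  have "(\<Sum>k\<in>?L. \<Prod>j\<in>u. fourier_weight (k j))
      = (\<Sum>c\<in>(\<Pi>\<^sub>E j\<in>u. {-M..M}). \<Sum>k\<in>{k\<in>?L. cl k = c}. \<Prod>j\<in>u. fourier_weight (k j))"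
    using finL clM assms(1) by (intro sum.group[symmetric] finite_PiE) auto
  also have "\<dots> \<le> (\<Sum>c\<in>(\<Pi>\<^sub>E j\<in>u. {-M..M}). 1 / \<sigma>)"
  proof (rule sum_mono)
    fix c :: "nat \<Rightarrow> int"
    show "(\<Sum>k\<in>{k\<in>?L. cl k = c}. \<Prod>j\<in>u. fourier_weight (k j)) \<le> 1 / \<sigma>"
    proof (rule dyadic_class_sum_le[where c = c])
      show "finite {k\<in>?L. cl k = c}" using finL by (rule finite_subset[rotated]) auto
      show "{k\<in>?L. cl k = c} \<subseteq> (\<Pi>\<^sub>E j\<in>u. UNIV)" by (auto simp: L_def PiE_def)
      fix k k' assume kk: "k \<in> {k\<in>?L. cl k = c}" "k' \<in> {k\<in>?L. cl k = c}" "k \<noteq> k'"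
      have "k \<in> extensional u" "k' \<in> extensional u" using kk by (auto simp: L_def PiE_iff)
      then have "\<exists>j\<in>u. k j - k' j \<noteq> 0" using kk(3) by (metis extensionalityI eq_iff_diff_eq_0)
      moreover have "int N dvd (\<Sum>j\<in>u. (k j - k' j) * int (z j))"
        using kk by (auto simp: L_def left_diff_distrib sum_subtractf intro: dvd_diff)
      ultimately show "\<sigma> \<le> (\<Prod>j\<in>u. max 1 \<bar>real_of_int (k j - k' j)\<bar>)" by (rule \<sigma>)
    qed (use assms(1) finL nz \<sigma> in \<open>auto simp: cl_def \<sigma>_def L_def\<close>)
  qed
  also have "\<dots> = real_of_int (2 * M + 1) ^ card u / \<sigma>"
    using assms(1) M by (simp add: card_PiE)
  also have "\<dots> \<le> (2 * log 2 N + 1) ^ card u / \<sigma>"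
    using M by (intro divide_right_mono power_mono) (auto simp: M_def \<sigma>_def)
  also have "\<dots> \<le> (2 * log 2 N + 1) ^ card u / \<rho>"
    using \<rho>(1) assms(2) by (intro divide_left_mono) (auto simp: \<sigma>_def intro!: zero_le_power)
  finally show ?thesis .
qed

subsection \<open>The star discrepancy of lattice point sets\<close>

lemma frac_divide_nat: "frac (real a / real N) = real (a mod N) / real N"
proof (cases "N = 0")
  case False
  have "real a = real (a div N) * real N + real (a mod N)"
    by (metis div_mult_mod_eq of_nat_add of_nat_mult)
  moreover have "\<lfloor>real a / real N\<rfloor> = int (a div N)" by (rule floor_divide_of_nat_eq)
  ultimately show ?thesis
    using False by (simp only: frac_def of_int_of_nat_eq) (simp add: field_simps)
qed simp

text \<open>All coordinates of the points are multiples of 1/N, so comparing one with y j amounts to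
  comparing an integer with the ceiling of N y j.\<close>

lemma local_discrepancy_lattice_points:
  assumes "u \<in> coord_sets s" "N > 0" and y: "y \<in> (\<Pi>\<^sub>E j\<in>u. {0..<1})"
  shows "local_discrepancy u (projection u (lattice_points s N z)) y =
    1 / real N * (\<Sum>n<N. \<Prod>j\<in>u. of_bool (n * z j mod N < nat \<lceil>real N * y j\<rceil>)) - (\<Prod>j\<in>u. y j)"
proof -
  have u: "finite u" "u \<subseteq> {1..s}" using assms finite_coord_set by (auto simp: coord_sets_def)
  have i: "indicator (\<Pi>\<^sub>E j\<in>u. {0..<y j}) (restrict (\<lambda>j\<in>{1..s}. frac (real n * real (z j) / real N)) u)
      = (\<Prod>j\<in>u. of_bool (n * z j mod N < nat \<lceil>real N * y j\<rceil>) :: real)" for n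
  proof -
    have "frac (real n * real (z j) / real N) < y j \<longleftrightarrow> n * z j mod N < nat \<lceil>real N * y j\<rceil>" for j
    proof -
      have "frac (real n * real (z j) / real N) < y j \<longleftrightarrow> real (n * z j mod N) < real N * y j"
        using frac_divide_nat[of "n * z j" N] assms(2) by (simp add: pos_divide_less_eq mult.commute)
      also have "\<dots> \<longleftrightarrow> n * z j mod N < nat \<lceil>real N * y j\<rceil>"
        by (simp only: zless_nat_eq_int_zless less_ceiling_iff of_int_of_nat_eq)
      finally show ?thesis .
    qed
    then have "restrict (\<lambda>j\<in>{1..s}. frac (real n * real (z j) / real N)) u \<in> (\<Pi>\<^sub>E j\<in>u. {0..<y j})
      \<longleftrightarrow> (\<forall>j\<in>u. n * z j mod N < nat \<lceil>real N * y j\<rceil>)"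
      using u(2) by (auto simp: PiE_iff subset_iff)
    then show ?thesis using u(1) by (auto simp: indicator_def)
  qed
  show ?thesis
    unfolding local_discrepancy_def projection_def lattice_points_def
    by (simp add: image_mset.compositionality o_def i sum_unfold_sum_mset[symmetric] lessThan_atLeast0
        del: restrict_restrict One_nat_def)
qed

lemma local_discrepancy_le_1:
  assumes "u \<in> coord_sets s" "N > 0" "y \<in> (\<Pi>\<^sub>E j\<in>u. {0..<1})"
  shows "\<bar>local_discrepancy u (projection u (lattice_points s N z)) y\<bar> \<le> 1"
proof -
  have y: "0 \<le> y j \<and> y j \<le> 1" if "j \<in> u" for j using assms(3) that by (force simp: PiE_iff)
  define S :: real where "S = (\<Sum>n<N. \<Prod>j\<in>u. of_bool (n * z j mod N < nat \<lceil>real N * y j\<rceil>))"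
  have "S \<le> (\<Sum>n<N. 1)" unfolding S_def by (intro sum_mono prod_le_1) auto
  moreover have "S \<ge> 0" unfolding S_def by (intro sum_nonneg prod_nonneg) auto
  moreover have "0 \<le> (\<Prod>j\<in>u. y j)" "(\<Prod>j\<in>u. y j) \<le> 1"
    using y by (auto intro!: prod_nonneg prod_le_1)
  ultimately have "0 \<le> 1 / real N * S" "1 / real N * S \<le> 1" "0 \<le> (\<Prod>j\<in>u. y j)" "(\<Prod>j\<in>u. y j) \<le> 1"
    using assms(2) by (auto simp: field_simps)
  then show ?thesis
    unfolding local_discrepancy_lattice_points[OF assms] S_def[symmetric] by linarith
qed

text \<open>Rounding each y j up to a multiple of 1/N leaves the number of points in the box
  unchanged and moves each side by at most 1/N. The volume changes by at most the sum of these
  errors, since all factors lie in [0,1].\<close>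

lemma local_discrepancy_le:
  fixes \<rho> :: real
  assumes u: "u \<in> coord_sets s" and N: "N > 0" and y: "y \<in> (\<Pi>\<^sub>E j\<in>u. {0..<1})"
    and \<rho>: "\<rho> > 0" "\<And>k. \<exists>j\<in>u. k j \<noteq> 0 \<Longrightarrow> int N dvd (\<Sum>j\<in>u. k j * int (z j))
      \<Longrightarrow> \<rho> \<le> (\<Prod>j\<in>u. max 1 \<bar>real_of_int (k j)\<bar>)"
  shows "\<bar>local_discrepancy u (projection u (lattice_points s N z)) y\<bar>
    \<le> real (card u) / real N + (2 * log 2 N + 1) ^ card u / \<rho>"
proof -
  define m where "m = (\<lambda>j. nat \<lceil>real N * y j\<rceil>)"
  have fin: "finite u" using u by (rule finite_coord_set)
  have m: "m j \<le> N \<and> \<bar>real (m j) / real N - y j\<bar> \<le> 1 / real N \<and> 0 \<le> y j \<and> y j \<le> 1" if "j \<in> u" for j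
  proof -
    have yj: "0 \<le> y j" "y j < 1" using y that by (auto simp: PiE_iff)
    have Ny: "0 \<le> real N * y j" "real N * y j \<le> real N"
      using yj N by (simp_all add: mult_left_le)
    have c: "real (m j) = real_of_int \<lceil>real N * y j\<rceil>"
      using Ny by (simp add: m_def)
    have "m j \<le> N" using Ny by (simp add: m_def ceiling_le_iff nat_le_iff)
    moreover have "\<bar>real (m j) - real N * y j\<bar> \<le> 1" unfolding c by linarith
    then have "\<bar>(real (m j) - real N * y j) / real N\<bar> \<le> 1 / real N"
      by (simp add: divide_right_mono)
    then have "\<bar>real (m j) / real N - y j\<bar> \<le> 1 / real N"
      using N by (simp add: diff_divide_distrib)
    ultimately show ?thesis using yj by simp
  qed
  define S :: real where "S = 1 / real N * (\<Sum>n<N. \<Prod>j\<in>u. of_bool (n * z j mod N < m j))"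
  have 1: "\<bar>S - (\<Prod>j\<in>u. real (m j) / real N)\<bar> \<le> (2 * log 2 N + 1) ^ card u / \<rho>"
    unfolding S_def using m
    by (intro order_trans[OF lattice_count_bound[OF N fin] dual_lattice_sum_le[OF fin N \<rho>]]) auto
  have "norm ((\<Prod>j\<in>u. real (m j) / real N) - (\<Prod>j\<in>u. y j)) \<le> (\<Sum>j\<in>u. norm (real (m j) / real N - y j))"
    using m N by (intro norm_prod_diff) auto
  also have "\<dots> \<le> (\<Sum>j\<in>u. 1 / real N)" using m by (intro sum_mono) auto
  finally have 2: "\<bar>(\<Prod>j\<in>u. real (m j) / real N) - (\<Prod>j\<in>u. y j)\<bar> \<le> real (card u) / real N"
    by simp
  show ?thesis
    using 1 2 unfolding local_discrepancy_lattice_points[OF u N y] S_def m_def by linarith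
qed

text \<open>Bounds are required only on sets of positive weight: they will contain a division by the
  other weight, which may vanish where this one does.\<close>

lemma weighted_star_discrepancy_le:
  assumes s: "s \<ge> 1" and w: "weights \<gamma>"
    and b: "\<And>u y. u \<in> coord_sets s \<Longrightarrow> \<gamma> u > 0 \<Longrightarrow> y \<in> (\<Pi>\<^sub>E j\<in>u. {0..<1})
        \<Longrightarrow> \<bar>local_discrepancy u (projection u P) y\<bar> \<le> b u"
    and M: "\<And>u. u \<in> coord_sets s \<Longrightarrow> \<gamma> u > 0 \<Longrightarrow> \<gamma> u * b u \<le> M" "M \<ge> 0"
  shows "weighted_star_discrepancy \<gamma> s P \<le> M"
  unfolding weighted_star_discrepancy_def
proof (rule Max.boundedI)
  have "{1} \<in> coord_sets s" using s by (auto simp: coord_sets_def)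
  then show "(\<lambda>u. \<gamma> u * (SUP y\<in>(\<Pi>\<^sub>E j\<in>u. {0..<1}). \<bar>local_discrepancy u (projection u P) y\<bar>)) ` coord_sets s \<noteq> {}"
    by blast
next
  fix x assume "x \<in> (\<lambda>u. \<gamma> u * (SUP y\<in>(\<Pi>\<^sub>E j\<in>u. {0..<1}). \<bar>local_discrepancy u (projection u P) y\<bar>)) ` coord_sets s"
  then obtain u where u: "u \<in> coord_sets s"
    and x: "x = \<gamma> u * (SUP y\<in>(\<Pi>\<^sub>E j\<in>u. {0..<1}). \<bar>local_discrepancy u (projection u P) y\<bar>)" by auto
  show "x \<le> M"
  proof (cases "\<gamma> u > 0")
    case True
    have "(SUP y\<in>(\<Pi>\<^sub>E j\<in>u. {0..<1}). \<bar>local_discrepancy u (projection u P) y\<bar>) \<le> b u"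
      by (rule cSUP_least) (use b[OF u True] in \<open>auto simp: PiE_eq_empty_iff\<close>)
    then have "x \<le> \<gamma> u * b u" unfolding x using True by (intro mult_left_mono) auto
    then show ?thesis using M(1)[OF u True] by simp
  next
    case False
    then have "\<gamma> u = 0" using w coord_sets_weight_index[OF u] by (force simp: weights_def)
    then show ?thesis using M(2) x by simp
  qed
qed (simp add: finite_coord_sets)

section \<open>Lower bounds on dual vectors from the criterion\<close>

text \<open>The criterion contains only vectors without zero coordinates, so k is restricted to its
  support v. The term of \<open>restrict k v\<close> is at most the whole criterion, and
  \<open>\<gamma> u \<le> \<gamma> v\<close>. The product form avoids dividing by a criterion not
  yet known to be positive.\<close>

lemma weight_le_P_criterion:
  assumes \<alpha>: "\<alpha> > 1 / 2" and w: "weights \<gamma>"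
    and mono: "\<And>u v. u \<in> weight_index \<Longrightarrow> v \<in> weight_index \<Longrightarrow> v \<subseteq> u \<Longrightarrow> \<gamma> v \<ge> \<gamma> u"
    and u: "u \<in> coord_sets s" and k: "\<exists>j\<in>u. k j \<noteq> 0" "int N dvd (\<Sum>j\<in>u. k j * int (z j))"
  shows "\<gamma> u \<le> P_criterion \<alpha> \<gamma> N s z * (\<Prod>j\<in>u. max 1 \<bar>real_of_int (k j)\<bar>) powr (2 * \<alpha>)"
proof -
  define v where "v = {j\<in>u. k j \<noteq> 0}"
  have fin: "finite u" using u by (rule finite_coord_set)
  have v: "v \<in> coord_sets s" "finite v" "v \<subseteq> u" using u k fin by (auto simp: v_def coord_sets_def)
  define Q where "Q = (\<Prod>j\<in>u. max 1 \<bar>real_of_int (k j)\<bar>)"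
  have Q: "Q \<ge> 1" unfolding Q_def by (intro prod_ge_1) auto
  have "Q = (\<Prod>j\<in>v. max 1 \<bar>real_of_int (k j)\<bar>)"
    unfolding Q_def using fin by (intro prod.mono_neutral_right) (auto simp: v_def)
  also have "\<dots> = (\<Prod>j\<in>v. \<bar>real_of_int (k j)\<bar>)"
  proof (intro prod.cong refl)
    fix j assume "j \<in> v"
    then have "1 \<le> \<bar>k j\<bar>" by (auto simp: v_def)
    then have "1 \<le> real_of_int \<bar>k j\<bar>" by (simp only: of_int_1_le_iff)
    then show "max 1 \<bar>real_of_int (k j)\<bar> = \<bar>real_of_int (k j)\<bar>" by simp
  qed
  finally have Qv: "(\<Prod>j\<in>v. \<bar>real_of_int (k j)\<bar> powr (-(2 * \<alpha>))) = Q powr (-(2 * \<alpha>))"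
    by (simp add: prod_powr_distrib)
  have \<gamma>0: "\<gamma> w \<ge> 0" if "w \<in> coord_sets s" for w
    using w coord_sets_weight_index[OF that] by (auto simp: weights_def)
  have "(\<Sum>j\<in>u. k j * int (z j)) = (\<Sum>j\<in>v. k j * int (z j))"
    using fin by (intro sum.mono_neutral_right) (auto simp: v_def)
  then have kv: "restrict k v \<in> dual_lattice N z v"
    using k(2) by (auto simp: dual_lattice_def cong_0_iff v_def)
  have "Q powr (-(2 * \<alpha>)) = (\<Sum>k'\<in>{restrict k v}. \<Prod>j\<in>v. \<bar>real_of_int (k' j)\<bar> powr (-(2 * \<alpha>)))"
    using Qv by simp
  also have "\<dots> \<le> dual_sum (2 * \<alpha>) N z v"
    unfolding dual_sum_def using kv \<alpha> v(2)
    by (intro finite_sum_le_infsum summable_prod_powr dual_lattice_subset prod_nonneg) auto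
  finally have "\<gamma> v * Q powr (-(2 * \<alpha>)) \<le> \<gamma> v * dual_sum (2 * \<alpha>) N z v"
    using \<gamma>0[OF v(1)] by (intro mult_left_mono) auto
  also have "\<dots> \<le> P_criterion \<alpha> \<gamma> N s z"
    unfolding P_criterion_eq using v(1) finite_coord_sets
    by (intro member_le_sum[where f = "\<lambda>v. \<gamma> v * dual_sum (2 * \<alpha>) N z v"] mult_nonneg_nonneg \<gamma>0 dual_sum_nonneg) auto
  finally have "\<gamma> v * Q powr (-(2 * \<alpha>)) \<le> P_criterion \<alpha> \<gamma> N s z" .
  moreover have "\<gamma> u \<le> \<gamma> v"
    using mono coord_sets_weight_index[OF u] coord_sets_weight_index[OF v(1)] v(3) by blast
  then have "\<gamma> u * Q powr (-(2 * \<alpha>)) \<le> \<gamma> v * Q powr (-(2 * \<alpha>))" by (intro mult_right_mono) auto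
  ultimately have "\<gamma> u * Q powr (-(2 * \<alpha>)) \<le> P_criterion \<alpha> \<gamma> N s z" by linarith
  then show ?thesis using Q unfolding Q_def[symmetric] by (simp add: powr_minus field_simps)
qed

lemma local_discrepancy_le_P_criterion:
  assumes \<alpha>: "\<alpha> > 1 / 2" and w: "weights \<gamma>"
    and mono: "\<And>u v. u \<in> weight_index \<Longrightarrow> v \<in> weight_index \<Longrightarrow> v \<subseteq> u \<Longrightarrow> \<gamma> v \<ge> \<gamma> u"
    and u: "u \<in> coord_sets s" and N: "N > 0" and y: "y \<in> (\<Pi>\<^sub>E j\<in>u. {0..<1})" and \<gamma>u: "\<gamma> u > 0"
  shows "\<bar>local_discrepancy u (projection u (lattice_points s N z)) y\<bar>
    \<le> real (card u) / real N + (2 * log 2 N + 1) ^ card u *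
        (P_criterion \<alpha> \<gamma> N s z powr (1 / (2 * \<alpha>)) / \<gamma> u powr (1 / (2 * \<alpha>)))"
proof -
  let ?P = "P_criterion \<alpha> \<gamma> N s z"
  have "u \<noteq> {}" using u by (auto simp: coord_sets_def)
  \<comment> \<open>The constant vector N is dual to every z; through it a positive
    \<open>\<gamma> u\<close> makes the criterion positive.\<close>
  then have "\<gamma> u \<le> ?P * (\<Prod>j\<in>u. max 1 \<bar>real_of_int (int N)\<bar>) powr (2 * \<alpha>)"
    using N by (intro weight_le_P_criterion[OF \<alpha> w mono u, where k = "\<lambda>_. int N"]) (auto simp: sum_distrib_left[symmetric])
  then have P: "?P > 0" using \<gamma>u by (smt (verit) mult_nonneg_nonpos2 powr_ge_zero mult.commute)
  define \<rho> where "\<rho> = (\<gamma> u / ?P) powr (1 / (2 * \<alpha>))"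
  have "\<rho> \<le> (\<Prod>j\<in>u. max 1 \<bar>real_of_int (k j)\<bar>)"
    if k: "\<exists>j\<in>u. k j \<noteq> 0" "int N dvd (\<Sum>j\<in>u. k j * int (z j))" for k
  proof -
    define Q where "Q = (\<Prod>j\<in>u. max 1 \<bar>real_of_int (k j)\<bar>)"
    have Q: "Q \<ge> 1" unfolding Q_def by (intro prod_ge_1) auto
    have "\<gamma> u / ?P \<le> Q powr (2 * \<alpha>)"
      using weight_le_P_criterion[OF \<alpha> w mono u k] P by (simp add: Q_def field_simps)
    then have "\<rho> \<le> (Q powr (2 * \<alpha>)) powr (1 / (2 * \<alpha>))"
      unfolding \<rho>_def using \<gamma>u P \<alpha> by (intro powr_mono2) auto
    also have "\<dots> = Q" using \<alpha> Q by (simp add: powr_powr)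
    finally show ?thesis by (simp add: Q_def)
  qed
  moreover have "\<rho> > 0" using \<gamma>u P by (simp add: \<rho>_def)
  ultimately have "\<bar>local_discrepancy u (projection u (lattice_points s N z)) y\<bar>
      \<le> real (card u) / real N + (2 * log 2 N + 1) ^ card u / \<rho>"
    by (intro local_discrepancy_le[OF u N y])
  then show ?thesis using \<gamma>u P by (simp add: \<rho>_def powr_divide)
qed

text \<open>The common core for general and product weights, with all hypotheses as real
  inequalities. The criterion is a sum over u, so \<open>A\<close> bounds a sum; the discrepancy is
  a maximum over u, so \<open>B\<close> and \<open>D\<close> need only bound single terms.\<close>

lemma cbc_discrepancy_bound:
  fixes A B D q q' q'' lam \<delta> :: real
  assumes \<alpha>: "\<alpha> > 1 / 2" and w: "weights \<gamma>" and w': "weights \<gamma>'"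
    and mono: "\<And>u v. u \<in> weight_index \<Longrightarrow> v \<in> weight_index \<Longrightarrow> v \<subseteq> u \<Longrightarrow> \<gamma> v \<ge> \<gamma> u"
    and lam: "1 / (2 * \<alpha>) < lam" "lam \<le> 1" and \<delta>: "\<delta> > 0"
    and A: "A \<ge> 0" "\<And>s. s \<ge> 1 \<Longrightarrow> (\<Sum>u\<in>coord_sets s. \<gamma> u powr lam * (2 * zeta (2 * \<alpha> * lam)) ^ card u) \<le> A * real s powr q"
    and B: "B \<ge> 0" "\<And>s u. s \<ge> 1 \<Longrightarrow> u \<in> coord_sets s \<Longrightarrow> \<gamma>' u * real (card u) \<le> B * real s powr q'"
    and D: "D \<ge> 0" "\<And>u. u \<in> weight_index \<Longrightarrow> \<gamma> u = 0 \<Longrightarrow> \<gamma>' u = 0"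
      "\<And>s N u. s \<ge> 1 \<Longrightarrow> N \<ge> 1 \<Longrightarrow> u \<in> coord_sets s \<Longrightarrow> \<gamma> u > 0 \<Longrightarrow>
        \<gamma>' u / \<gamma> u powr (1 / (2 * \<alpha>)) * (2 * log 2 (real N)) ^ card u \<le> D * real s powr q'' * real (totient N) powr \<delta>"
  shows "\<exists>C>0. \<forall>s N z. s \<ge> 1 \<longrightarrow> N \<ge> 2 \<longrightarrow> cbc_output \<alpha> \<gamma> N s z \<longrightarrow>
           weighted_star_discrepancy \<gamma>' s (lattice_points s N z)
             \<le> C * real s powr (max q' (q / (2 * \<alpha> * lam) + q''))
                 * real (totient N) powr (- 1 / (2 * \<alpha> * lam) + \<delta>)"
proof -
  define e where "e = 1 / (2 * \<alpha> * lam)"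
  have lam0: "lam > 0" using \<alpha> lam by (smt (verit) divide_pos_pos)
  have "2 * \<alpha> * lam > 1" using \<alpha> lam by (simp add: field_simps)
  then have e: "0 < e" "e < 1" by (auto simp: e_def)
  \<comment> \<open>\<open>B\<close> comes from the rounding error |u|/N, the product from the dual
    lattice sum, where \<open>2 powr \<delta>\<close> accounts for the totient of 2N; the summand 1
    makes C positive.\<close>
  define C where "C = B + A powr e * D * 2 powr \<delta> + 1"
  have C: "C > 0" using A B D by (simp add: C_def add_nonneg_pos)
  have "weighted_star_discrepancy \<gamma>' s (lattice_points s N z)
      \<le> C * real s powr (max q' (q * e + q'')) * real (totient N) powr (- e + \<delta>)"
    if s: "s \<ge> 1" and N: "N \<ge> 2" and z: "cbc_output \<alpha> \<gamma> N s z" for s N z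
  proof -
    let ?P = "P_criterion \<alpha> \<gamma> N s z"
    define \<phi> where "\<phi> = real (totient N)"
    have \<phi>: "1 \<le> \<phi>" "\<phi> \<le> real N"
      using N totient_le[of N] totient_gt_0_iff[of N] unfolding \<phi>_def by (auto simp del: totient_gt_0_iff)
    have s1: "1 \<le> real s" using s by simp
    have \<gamma>0: "\<gamma> w \<ge> 0" if "w \<in> coord_sets s" for w
      using w coord_sets_weight_index[OF that] by (auto simp: weights_def)
    have P0: "?P \<ge> 0"
      by (auto simp: P_criterion_eq intro!: sum_nonneg mult_nonneg_nonneg dual_sum_nonneg \<gamma>0)
    have "?P powr lam \<le> 1 / \<phi> * (A * real s powr q)"
      unfolding \<phi>_def
      by (rule order_trans[OF cbc_P_criterion_bound[OF \<alpha> lam w N z] mult_left_mono[OF A(2)[OF s]]]) simp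
    \<comment> \<open>The exponent e turns \<open>lam\<close> into 1/(2 \<alpha>), the power of the
      criterion that enters the discrepancy bound.\<close>
    then have "(?P powr lam) powr e \<le> (1 / \<phi> * (A * real s powr q)) powr e"
      using e by (intro powr_mono2) auto
    also have "\<dots> = A powr e * real s powr (q * e) * \<phi> powr (- e)"
      using \<phi> A by (simp add: powr_mult powr_divide powr_powr powr_minus field_simps)
    also have "(?P powr lam) powr e = ?P powr (1 / (2 * \<alpha>))"
      using lam0 by (simp add: powr_powr e_def)
    finally have P: "?P powr (1 / (2 * \<alpha>)) \<le> A powr e * real s powr (q * e) * \<phi> powr (- e)" .
    define b where "b = (\<lambda>u. real (card u) / real N + (2 * log 2 N + 1) ^ card u *
        (?P powr (1 / (2 * \<alpha>)) / \<gamma> u powr (1 / (2 * \<alpha>))))"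
    let ?R = "C * real s powr (max q' (q * e + q'')) * \<phi> powr (- e + \<delta>)"
    show ?thesis unfolding \<phi>_def[symmetric]
    proof (rule weighted_star_discrepancy_le[OF s w', where b = b])
      show "0 \<le> ?R" using C by simp
    next
      fix u and y :: "nat \<Rightarrow> real" assume u: "u \<in> coord_sets s" "\<gamma>' u > 0" "y \<in> (\<Pi>\<^sub>E j\<in>u. {0..<1})"
      have "\<gamma> u > 0" using \<gamma>0[OF u(1)] D(2)[OF coord_sets_weight_index[OF u(1)]] u(2) by force
      then show "\<bar>local_discrepancy u (projection u (lattice_points s N z)) y\<bar> \<le> b u"
        unfolding b_def using N by (intro local_discrepancy_le_P_criterion[OF \<alpha> w mono u(1) _ u(3)]) auto
    next
      fix u assume u: "u \<in> coord_sets s" "\<gamma>' u > 0"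
      have \<gamma>u: "\<gamma> u > 0" using \<gamma>0[OF u(1)] D(2)[OF coord_sets_weight_index[OF u(1)]] u(2) by force
      have "\<gamma>' u * (real (card u) / real N) \<le> B * real s powr q' * (1 / real N)"
        using mult_right_mono[OF B(2)[OF s u(1)], of "1 / real N"] by simp
      also have "\<dots> \<le> B * real s powr (max q' (q * e + q'')) * \<phi> powr (- e + \<delta>)"
      proof (intro mult_mono mult_left_mono powr_mono B(1))
        \<comment> \<open>As e < 1 and \<delta> > 0, the rounding error 1/N is dominated by the
          target rate.\<close>
        have "1 / real N \<le> \<phi> powr (-1)" using \<phi> by (simp add: powr_minus field_simps)
        also have "\<dots> \<le> \<phi> powr (- e + \<delta>)" using \<phi> e \<delta> by (intro powr_mono) auto
        finally show "1 / real N \<le> \<phi> powr (- e + \<delta>)" .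
      qed (use s1 B in auto)
      finally have 1: "\<gamma>' u * (real (card u) / real N)
        \<le> B * real s powr (max q' (q * e + q'')) * \<phi> powr (- e + \<delta>)" .
      have "\<gamma>' u / \<gamma> u powr (1 / (2 * \<alpha>)) * (2 * log 2 N + 1) ^ card u
          \<le> \<gamma>' u / \<gamma> u powr (1 / (2 * \<alpha>)) * (2 * log 2 (real (2 * N))) ^ card u"
        using N u(2) by (intro mult_left_mono power_mono) (auto simp: log_mult)
      also have "\<dots> \<le> D * real s powr q'' * real (totient (2 * N)) powr \<delta>"
        using N by (intro D(3)[OF s _ u(1) \<gamma>u]) auto
      also have "\<dots> \<le> D * real s powr q'' * (2 * \<phi>) powr \<delta>"
        using D(1) \<delta> by (intro mult_left_mono powr_mono2) (auto simp: \<phi>_def totient_double)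
      finally have r: "\<gamma>' u / \<gamma> u powr (1 / (2 * \<alpha>)) * (2 * log 2 N + 1) ^ card u
          \<le> D * real s powr q'' * (2 * \<phi>) powr \<delta>" .
      have "\<gamma>' u / \<gamma> u powr (1 / (2 * \<alpha>)) * (2 * log 2 N + 1) ^ card u * ?P powr (1 / (2 * \<alpha>))
          \<le> (D * real s powr q'' * (2 * \<phi>) powr \<delta>) * (A powr e * real s powr (q * e) * \<phi> powr (- e))"
        by (rule mult_mono[OF r P]) (use D(1) in auto)
      also have "\<dots> = A powr e * D * 2 powr \<delta> * real s powr (q * e + q'') * \<phi> powr (- e + \<delta>)"
        using \<phi> by (simp only: powr_mult powr_add mult_ac)
      also have "\<dots> \<le> A powr e * D * 2 powr \<delta> * real s powr (max q' (q * e + q'')) * \<phi> powr (- e + \<delta>)"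
        using D(1) s1 by (intro mult_right_mono mult_left_mono powr_mono) auto
      finally have 2: "\<gamma>' u * ((2 * log 2 N + 1) ^ card u * (?P powr (1 / (2 * \<alpha>)) / \<gamma> u powr (1 / (2 * \<alpha>))))
          \<le> A powr e * D * 2 powr \<delta> * real s powr (max q' (q * e + q'')) * \<phi> powr (- e + \<delta>)"
        by (simp add: mult_ac)
      have "\<gamma>' u * b u \<le> (B + A powr e * D * 2 powr \<delta>) * real s powr (max q' (q * e + q'')) * \<phi> powr (- e + \<delta>)"
        unfolding b_def distrib_left[of "\<gamma>' u"] using add_mono[OF 1 2] by (simp add: algebra_simps)
      also have "\<dots> \<le> ?R"
        by (intro mult_right_mono) (auto simp: C_def)
      finally show "\<gamma>' u * b u \<le> ?R" .
    qed
  qed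
  then show ?thesis using C by (intro exI[of _ C]) (simp add: e_def)
qed

subsection \<open>From the hypotheses of the corollary to real bounds\<close>

lemma SUP_ennreal_bound:
  assumes "(SUP x\<in>X. f x :: ennreal) < \<infinity>"
  shows "\<exists>M::real\<ge>0. \<forall>x\<in>X. f x \<le> ennreal M"
proof (intro exI conjI ballI)
  have "(SUP x\<in>X. f x) = ennreal (enn2real (SUP x\<in>X. f x))" using assms by simp
  then show "f x \<le> ennreal (enn2real (SUP x\<in>X. f x))" if "x \<in> X" for x
    using that by (metis SUP_upper)
qed simp

text \<open>A positive c' over c = 0 makes the left side infinite, provided T > 0, because infinity
  times 0 is 0 in \<open>ennreal\<close>.\<close>

lemma weight_ratio_bound:
  assumes \<gamma>: "c \<ge> 0" and \<gamma>': "c' \<ge> 0" and "\<alpha> > 0" "M \<ge> 0" "K > 0" "T \<ge> 0"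
    and le: "ennreal (1 / K) * (weight_ratio \<alpha> c' c * ennreal T) \<le> ennreal M"
  shows "c = 0 \<Longrightarrow> T > 0 \<Longrightarrow> c' = 0" and "c > 0 \<Longrightarrow> c' / c powr (1 / (2 * \<alpha>)) * T \<le> M * K"
proof -
  assume "c = 0" "T > 0"
  show "c' = 0"
  proof (rule ccontr)
    assume "c' \<noteq> 0"
    then have "weight_ratio \<alpha> c' c = top" using \<gamma>' \<open>c = 0\<close> by (simp add: weight_ratio_def)
    then have "ennreal (1 / K) * (weight_ratio \<alpha> c' c * ennreal T) = top"
      using \<open>T > 0\<close> assms(5) by (simp add: ennreal_mult_eq_top_iff)
    then show False using le by (simp add: top_unique)
  qed
next
  assume "c > 0"
  then have "weight_ratio \<alpha> c' c = ennreal (c' / c powr (1 / (2 * \<alpha>)))"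
    using \<gamma>' by (simp add: weight_ratio_def divide_ennreal)
  moreover have "ennreal (1 / K * (c' / c powr (1 / (2 * \<alpha>)) * T))
      = ennreal (1 / K) * (ennreal (c' / c powr (1 / (2 * \<alpha>))) * ennreal T)"
  proof -
    have "0 \<le> 1 / K" "0 \<le> c' / c powr (1 / (2 * \<alpha>))" "0 \<le> c' / c powr (1 / (2 * \<alpha>)) * T"
      using \<gamma>' assms(5,6) by auto
    then show ?thesis using assms(6) by (simp only: ennreal_mult)
  qed
  ultimately have "ennreal (1 / K * (c' / c powr (1 / (2 * \<alpha>)) * T)) \<le> ennreal M"
    using le by simp
  then have "1 / K * (c' / c powr (1 / (2 * \<alpha>)) * T) \<le> M" using assms(4) by simp
  then have "c' / c powr (1 / (2 * \<alpha>)) * T / K \<le> M" by (simp add: mult.commute[of K])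
  then show "c' / c powr (1 / (2 * \<alpha>)) * T \<le> M * K" using assms(5) by (simp only: pos_divide_le_eq)
qed

lemma general_weights_bound:
  assumes \<alpha>: "\<alpha> > 1 / 2" and w: "weights \<gamma>" and w': "weights \<gamma>'"
    and mono: "\<And>u v. u \<in> weight_index \<Longrightarrow> v \<in> weight_index \<Longrightarrow> v \<subseteq> u \<Longrightarrow> \<gamma> v \<ge> \<gamma> u"
    and lam: "1 / (2 * \<alpha>) < lam" "lam \<le> 1" and \<delta>: "\<delta> > 0"
    and A: "(SUP s\<in>{1::nat..}. ennreal (1 / real s powr q *
           (\<Sum>u\<in>coord_sets s. \<gamma> u powr lam * (2 * zeta (2 * \<alpha> * lam)) ^ card u))) < \<infinity>"
    and B: "(SUP s\<in>{1::nat..}. ennreal (1 / real s powr q' *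
           (\<Sum>u\<in>coord_sets s. \<gamma>' u * real (card u)))) < \<infinity>"
    and D: "(SUP (s, N)\<in>{1::nat..} \<times> {1::nat..}.
           ennreal (1 / (real s powr q'' * real (totient N) powr \<delta>)) *
           (\<Sum>u\<in>coord_sets s.
              weight_ratio \<alpha> (\<gamma>' u) (\<gamma> u) * ennreal ((2 * log 2 (real N)) ^ card u))) < \<infinity>"
  shows "\<exists>C>0. \<forall>s N z. s \<ge> 1 \<longrightarrow> N \<ge> 2 \<longrightarrow> cbc_output \<alpha> \<gamma> N s z \<longrightarrow>
           weighted_star_discrepancy \<gamma>' s (lattice_points s N z)
             \<le> C * real s powr (max q' (q / (2 * \<alpha> * lam) + q''))
                 * real (totient N) powr (- 1 / (2 * \<alpha> * lam) + \<delta>)"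
proof -
  have \<gamma>0: "\<gamma> u \<ge> 0" "\<gamma>' u \<ge> 0" if "u \<in> weight_index" for u
    using w w' that by (auto simp: weights_def)
  obtain MA where MA: "MA \<ge> 0" "\<And>s. s \<in> {1::nat..} \<Longrightarrow> ennreal (1 / real s powr q *
           (\<Sum>u\<in>coord_sets s. \<gamma> u powr lam * (2 * zeta (2 * \<alpha> * lam)) ^ card u)) \<le> ennreal MA"
    using SUP_ennreal_bound[OF A] by blast
  obtain MB where MB: "MB \<ge> 0" "\<And>s. s \<in> {1::nat..} \<Longrightarrow> ennreal (1 / real s powr q' *
           (\<Sum>u\<in>coord_sets s. \<gamma>' u * real (card u))) \<le> ennreal MB"
    using SUP_ennreal_bound[OF B] by blast
  obtain MD where MD: "MD \<ge> 0" "\<And>x. x \<in> {1::nat..} \<times> {1::nat..} \<Longrightarrow> (case x of (s, N) \<Rightarrow>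
           ennreal (1 / (real s powr q'' * real (totient N) powr \<delta>)) *
           (\<Sum>u\<in>coord_sets s.
              weight_ratio \<alpha> (\<gamma>' u) (\<gamma> u) * ennreal ((2 * log 2 (real N)) ^ card u))) \<le> ennreal MD"
    using SUP_ennreal_bound[OF D] by blast
  \<comment> \<open>Single terms are extracted while still in \<open>ennreal\<close>, before the
    ratios are known to be finite.\<close>
  have MD': "ennreal (1 / (real s powr q'' * real (totient N) powr \<delta>)) *
      (weight_ratio \<alpha> (\<gamma>' u) (\<gamma> u) * ennreal ((2 * log 2 (real N)) ^ card u)) \<le> ennreal MD"
    if "s \<ge> 1" "N \<ge> 1" "u \<in> coord_sets s" for s N u
  proof -
    have "weight_ratio \<alpha> (\<gamma>' u) (\<gamma> u) * ennreal ((2 * log 2 (real N)) ^ card u)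
      \<le> (\<Sum>u\<in>coord_sets s. weight_ratio \<alpha> (\<gamma>' u) (\<gamma> u) * ennreal ((2 * log 2 (real N)) ^ card u))"
      using that(3) finite_coord_sets by (intro sum_nonneg_leq_bound[OF _ _ refl]) auto
    then have "ennreal (1 / (real s powr q'' * real (totient N) powr \<delta>)) *
      (weight_ratio \<alpha> (\<gamma>' u) (\<gamma> u) * ennreal ((2 * log 2 (real N)) ^ card u)) \<le>
      ennreal (1 / (real s powr q'' * real (totient N) powr \<delta>)) *
           (\<Sum>u\<in>coord_sets s.
              weight_ratio \<alpha> (\<gamma>' u) (\<gamma> u) * ennreal ((2 * log 2 (real N)) ^ card u))"
      by (rule mult_left_mono) simp
    also have "\<dots> \<le> ennreal MD" using MD(2)[of "(s, N)"] that(1,2) by simp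
    finally show ?thesis .
  qed
  show ?thesis
  proof (rule cbc_discrepancy_bound[OF \<alpha> w w' mono lam \<delta> MA(1) _ MB(1) _ MD(1)])
    fix s :: nat assume s: "s \<ge> 1"
    have "1 / real s powr q * (\<Sum>u\<in>coord_sets s. \<gamma> u powr lam * (2 * zeta (2 * \<alpha> * lam)) ^ card u) \<le> MA"
      using iffD1[OF ennreal_le_iff[OF MA(1)] MA(2)[of s]] s by simp
    then show "(\<Sum>u\<in>coord_sets s. \<gamma> u powr lam * (2 * zeta (2 * \<alpha> * lam)) ^ card u) \<le> MA * real s powr q"
      using s by (simp add: pos_divide_le_eq)
  next
    fix s :: nat and u assume s: "s \<ge> 1" and u: "u \<in> coord_sets s"
    have "1 / real s powr q' * (\<Sum>u\<in>coord_sets s. \<gamma>' u * real (card u)) \<le> MB"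
      using iffD1[OF ennreal_le_iff[OF MB(1)] MB(2)[of s]] s by simp
    then have "(\<Sum>u\<in>coord_sets s. \<gamma>' u * real (card u)) \<le> MB * real s powr q'"
      using s by (simp add: pos_divide_le_eq)
    moreover have "\<gamma>' u * real (card u) \<le> (\<Sum>u\<in>coord_sets s. \<gamma>' u * real (card u))"
      using u finite_coord_sets \<gamma>0(2) coord_sets_weight_index
      by (intro member_le_sum[where f = "\<lambda>u. \<gamma>' u * real (card u)"]) auto
    ultimately show "\<gamma>' u * real (card u) \<le> MB * real s powr q'" by linarith
  next
    fix u assume u: "u \<in> weight_index" "\<gamma> u = 0"
    have "finite u" "u \<noteq> {}" "u \<subseteq> {1..}" using u(1) by (auto simp: weight_index_def)
    then have us: "u \<in> coord_sets (Max u)" and "Max u \<ge> 1"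
      by (auto simp: coord_sets_def Max_ge_iff subset_iff)
    \<comment> \<open>N = 2 makes the logarithmic factor positive; for N = 1 it vanishes and would
      hide an infinite ratio. \<open>Max u\<close> is a dimension in which u occurs.\<close>
    then show "\<gamma>' u = 0"
      using weight_ratio_bound(1)[OF \<gamma>0[OF u(1)] _ MD(1) _ _ MD'[OF \<open>Max u \<ge> 1\<close> _ us, of 2]] u \<alpha> by simp
  next
    fix s N :: nat and u assume *: "s \<ge> 1" "N \<ge> 1" and u: "u \<in> coord_sets s" "\<gamma> u > 0"
    have "\<gamma>' u / \<gamma> u powr (1 / (2 * \<alpha>)) * (2 * log 2 (real N)) ^ card u
        \<le> MD * (real s powr q'' * real (totient N) powr \<delta>)"
      using * u \<alpha> by (intro weight_ratio_bound(2)[OF \<gamma>0[OF coord_sets_weight_index[OF u(1)]] _ MD(1) _ _ MD'[OF * u(1)] u(2)]) auto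
    then show "\<gamma>' u / \<gamma> u powr (1 / (2 * \<alpha>)) * (2 * log 2 (real N)) ^ card u
        \<le> MD * real s powr q'' * real (totient N) powr \<delta>" by (simp add: mult.assoc)
  qed
qed

section \<open>Totients and products for product weights\<close>

text \<open>A prime p that already divides n multiplies the totient by p, a new prime by p - 1. Only
  p = 2 violates p \<le> (p - 1)^2, and it enters as a new prime at most once; hence the factor 2
  for even n.\<close>

lemma totient_lower_bound:
  "n > 0 \<Longrightarrow> n \<le> (if even n then 2 else 1) * totient n ^ 2"
proof (induction n rule: prime_divisors_induct)
  case (factor p n)
  have n: "n > 0" and IH: "n \<le> (if even n then 2 else 1) * totient n ^ 2" using factor by auto
  have p: "p \<ge> 2" using factor.hyps by (rule prime_ge_2_nat)
  show ?case
  proof (cases "p dvd n")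
    case True
    then have "totient (p * n) = totient n * p"
      using p factor.hyps by (simp add: totient_mult gcd_nat.absorb1 mult_ac)
    moreover have "p * n \<le> p * p * ((if even n then 2 else 1) * totient n ^ 2)"
      using IH p by (intro mult_mono) auto
    moreover have "even (p * n) \<longleftrightarrow> even n" using True by (metis dvd_trans even_mult_iff)
    ultimately show ?thesis by (simp add: power2_eq_square mult_ac)
  next
    case False
    then have "coprime p n" using factor.hyps by (simp add: prime_imp_coprime)
    then have t: "totient (p * n) = (p - 1) * totient n"
      using factor.hyps by (simp add: totient_mult_coprime totient_prime)
    show ?thesis
    proof (cases "p = 2")
      case True
      then show ?thesis using False IH t by simp
    next
      case False
      then obtain r where r: "p = r + 3" using p by (metis add.commute le_Suc_ex le_neq_implies_less Suc_leI numeral_2_eq_2 numeral_3_eq_3)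
      have "odd p" using False factor.hyps prime_odd_nat[of p] p by force
      have "p * n \<le> (p - 1) ^ 2 * ((if even n then 2 else 1) * totient n ^ 2)"
        using IH by (intro mult_mono) (auto simp: r power2_eq_square algebra_simps)
      then show ?thesis using \<open>odd p\<close> unfolding t by (simp add: power_mult_distrib mult_ac)
    qed
  qed
qed auto

text \<open>Converts the power of N produced by the logarithms into the power of the totient that
  the bound allows; the halved exponent reflects the square in the totient estimate.\<close>

lemma powr_le_totient_powr:
  assumes "N > 0" "\<delta> > 0"
  shows "real N powr (\<delta> / 2) \<le> 2 powr (\<delta> / 2) * real (totient N) powr \<delta>"
proof -
  have "N \<le> 2 * totient N ^ 2" using totient_lower_bound[OF assms(1)] by (auto split: if_splits)
  then have "real N \<le> real (2 * totient N ^ 2)" by (simp only: of_nat_le_iff)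
  then have "real N \<le> 2 * real (totient N) ^ 2" by simp
  then have "real N powr (\<delta> / 2) \<le> (2 * real (totient N) ^ 2) powr (\<delta> / 2)"
    using assms by (intro powr_mono2) auto
  also have "\<dots> = 2 powr (\<delta> / 2) * real (totient N) powr \<delta>"
    using assms by (simp add: powr_mult powr_powr powr_numeral[symmetric] del: powr_numeral)
  finally show ?thesis .
qed

lemma sum_coord_sets_prod_le:
  fixes x :: "nat \<Rightarrow> real"
  assumes "\<And>j. j \<ge> 1 \<Longrightarrow> x j \<ge> 0"
  shows "(\<Sum>u\<in>coord_sets s. \<Prod>j\<in>u. x j) \<le> (\<Prod>j=1..s. 1 + x j)"
proof -
  have "(\<Sum>u\<in>coord_sets s. \<Prod>j\<in>u. x j) \<le> (\<Sum>u\<in>Pow {1..s}. \<Prod>j\<in>u. x j)"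
    using assms by (intro sum_mono2) (auto simp: coord_sets_def intro!: prod_nonneg)
  also have "\<dots> = (\<Prod>j=1..s. x j + 1)" by (subst prod_add) auto
  finally show ?thesis by (simp add: add.commute)
qed

text \<open>Finitely many factors grow only polynomially in T, and the tail of the series makes the
  remaining factors contribute an arbitrarily small exponential rate.\<close>

lemma prod_one_plus_mult_le_exp:
  fixes r :: "nat \<Rightarrow> real"
  assumes r: "\<And>j. r j \<ge> 0" "summable r" and \<epsilon>: "\<epsilon> > 0"
  shows "\<exists>K>0. \<forall>n T. T \<ge> 0 \<longrightarrow> (\<Prod>j<n. 1 + r j * T) \<le> K * exp (\<epsilon> * T)"
proof -
  define \<eta> where "\<eta> = \<epsilon> / 2"
  have \<eta>: "\<eta> > 0" using \<epsilon> by (simp add: \<eta>_def)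
  obtain J where J: "\<And>n. n \<ge> J \<Longrightarrow> norm (\<Sum>i. r (i + n)) < \<eta>"
    using suminf_exist_split[OF \<eta> r(2)] by blast
  \<comment> \<open>The first J factors together may use the rate \<eta>, and the tail gets the
    other half of \<epsilon>. \<open>Suc J\<close> in place of J avoids a division by zero.\<close>
  define h where "h = \<eta> / real (Suc J)"
  have h: "h > 0" using \<eta> by (simp add: h_def)
  define R where "R = suminf r"
  have rR: "r j \<le> R" for j
    unfolding R_def using sum_le_suminf[OF r(2), of "{j}"] r(1) by simp
  have R: "R \<ge> 0" using rR[of 0] r(1)[of 0] by linarith
  \<comment> \<open>A factor 1 + r j T grows linearly in T and is absorbed by exp(h T) at the price
    of the constant 1 + R / h, paid once for each of the first J factors.\<close>
  define K where "K = (1 + R / h) ^ J"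
  have K: "K > 0" unfolding K_def using R h by (intro zero_less_power add_pos_nonneg) auto
  have "(\<Prod>j<n. 1 + r j * T) \<le> K * exp (\<epsilon> * T)" if T: "T \<ge> 0" for n T
  proof -
    have f: "1 \<le> 1 + r j * T" for j using r(1) T by simp
    have one: "1 + r j * T \<le> (1 + R / h) * exp (h * T)" for j
    proof -
      have "h * T \<ge> 0" using h T by simp
      then have e: "1 \<le> exp (h * T)" "h * T \<le> exp (h * T)"
        using exp_ge_add_one_self[of "h * T"] by linarith+
      have "r j * T \<le> R * T" using rR T by (intro mult_right_mono) auto
      also have "\<dots> = R / h * (h * T)" using h by simp
      also have "\<dots> \<le> R / h * exp (h * T)" using e R h by (intro mult_left_mono) auto
      finally have "1 + r j * T \<le> 1 * exp (h * T) + R / h * exp (h * T)" using e(1) by linarith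
      then show ?thesis by (simp only: distrib_right)
    qed
    \<comment> \<open>All factors are at least 1, so padding to J + n of them allows the split at J
      for every n, even n < J.\<close>
    have "(\<Prod>j<n. 1 + r j * T) \<le> (\<Prod>j<J + n. 1 + r j * T)"
      using f by (intro prod_mono2) (auto intro: order_trans[OF zero_le_one])
    also have "\<dots> = (\<Prod>j<J. 1 + r j * T) * (\<Prod>i<n. 1 + r (i + J) * T)"
      by (induction n) (simp_all add: add.commute mult_ac)
    also have "\<dots> \<le> (K * exp (\<eta> * T)) * exp (\<eta> * T)"
    proof (rule mult_mono)
      have "(\<Prod>j<J. 1 + r j * T) \<le> (\<Prod>j<J. (1 + R / h) * exp (h * T))"
        using one f by (intro prod_mono) (auto intro: order_trans[OF zero_le_one])
      also have "\<dots> = K * exp (real J * (h * T))"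
        by (simp add: K_def power_mult_distrib exp_of_nat_mult)
      also have "\<dots> \<le> K * exp (\<eta> * T)"
      proof -
        have "real J * h \<le> \<eta>" using \<eta> by (simp add: h_def field_simps)
        then have "real J * (h * T) \<le> \<eta> * T" using T by (simp add: mult.assoc[symmetric] mult_right_mono)
        then show ?thesis using K by simp
      qed
      finally show "(\<Prod>j<J. 1 + r j * T) \<le> K * exp (\<eta> * T)" .
      have "(\<Prod>i<n. 1 + r (i + J) * T) \<le> exp (\<Sum>i<n. r (i + J) * T)"
        using r(1) T by (intro prod_le_exp_sum) auto
      also have "(\<Sum>i<n. r (i + J) * T) = (\<Sum>i<n. r (i + J)) * T" by (simp add: sum_distrib_right)
      also have "\<dots> \<le> \<eta> * T"
      proof (rule mult_right_mono[OF _ T])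
        have "(\<Sum>i<n. r (i + J)) \<le> (\<Sum>i. r (i + J))"
          using r by (intro sum_le_suminf) auto
        then show "(\<Sum>i<n. r (i + J)) \<le> \<eta>" using J[of J] by simp
      qed
      finally show "(\<Prod>i<n. 1 + r (i + J) * T) \<le> exp (\<eta> * T)" by simp
    qed (use K r(1) T in \<open>auto intro!: prod_nonneg\<close>)
    also have "\<dots> = K * exp (\<epsilon> * T)" by (simp add: \<eta>_def mult.assoc exp_add[symmetric])
    finally show ?thesis .
  qed
  then show ?thesis using K by blast
qed

lemma prod_atLeast1_atMost: "(\<Prod>j=1..s. f j) = (\<Prod>j<s. f (Suc j))"
  by (rule prod.reindex_bij_witness[of _ Suc "\<lambda>j. j - 1"]) auto

lemma prod_one_plus_le_exp_suminf:
  fixes x :: "nat \<Rightarrow> real"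
  assumes "\<And>j. x j \<ge> 0" "summable x"
  shows "(\<Prod>j<n. 1 + x j) \<le> exp (suminf x)"
proof -
  have "(\<Prod>j<n. 1 + x j) \<le> exp (\<Sum>j<n. x j)" using assms by (intro prod_le_exp_sum) auto
  also have "\<dots> \<le> exp (suminf x)" using assms by (simp add: sum_le_suminf)
  finally show ?thesis .
qed

text \<open>The bound on the logarithmic factors is here a consequence, for every \<delta>, of the
  summability of the ratios: for product weights these factors form a product of terms 1 + r j T
  with T = 2 log_2 N, which grows more slowly than any power of N, uniformly in s.\<close>

lemma product_weights_bound:
  assumes \<alpha>: "\<alpha> > 1 / 2" and w: "weights \<gamma>" and w': "weights \<gamma>'"
    and mono: "\<And>u v. u \<in> weight_index \<Longrightarrow> v \<in> weight_index \<Longrightarrow> v \<subseteq> u \<Longrightarrow> \<gamma> v \<ge> \<gamma> u"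
    and pw: "product_weights \<gamma> g" and pw': "product_weights \<gamma>' g'"
    and lam: "1 / (2 * \<alpha>) < lam" "lam \<le> 1" and \<delta>: "\<delta> > 0"
    and sg: "(\<Sum>j. ennreal (g (Suc j) powr lam)) < \<infinity>"
    and sr: "(\<Sum>j. weight_ratio \<alpha> (g' (Suc j)) (g (Suc j))) < \<infinity>"
  shows "\<exists>C>0. \<forall>s N z. s \<ge> 1 \<longrightarrow> N \<ge> 2 \<longrightarrow> cbc_output \<alpha> \<gamma> N s z \<longrightarrow>
           weighted_star_discrepancy \<gamma>' s (lattice_points s N z)
             \<le> C * real (totient N) powr (- 1 / (2 * \<alpha> * lam) + \<delta>)"
proof -
  define e where "e = 1 / (2 * \<alpha>)"
  have e: "e > 0" using \<alpha> by (simp add: e_def)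
  have lam0: "lam > 0" using \<alpha> lam by (smt (verit) divide_pos_pos)
  have t: "2 * \<alpha> * lam > 1" using \<alpha> lam by (simp add: field_simps)
  have g: "g j \<ge> 0" "g' j \<ge> 0" if "j \<ge> 1" for j using pw pw' that by (auto simp: product_weights_def)
  have pu: "\<gamma> u = (\<Prod>j\<in>u. g j)" "\<gamma>' u = (\<Prod>j\<in>u. g' j)" if "u \<in> weight_index" for u
    using pw pw' that by (auto simp: product_weights_def)
  have u1: "j \<ge> 1" if "u \<in> weight_index" "j \<in> u" for u j using that by (auto simp: weight_index_def)
  \<comment> \<open>A zero of g at a positive value of g' would make one term of the ratio series
    infinite.\<close>
  have g0: "g' j = 0" if j: "j \<ge> 1" "g j = 0" for j
  proof (rule ccontr)
    assume "g' j \<noteq> 0"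
    then have "weight_ratio \<alpha> (g' (Suc (j - 1))) (g (Suc (j - 1))) = top"
      using j g[of j] by (simp add: weight_ratio_def)
    moreover have "weight_ratio \<alpha> (g' (Suc (j - 1))) (g (Suc (j - 1))) < \<infinity>"
      using sr by (rule ennreal_suminf_lessD)
    ultimately show False by simp
  qed
  define r where "r = (\<lambda>j. g' j / g j powr e)"
  have r0: "r j \<ge> 0" if "j \<ge> 1" for j using g that by (simp add: r_def)
  \<comment> \<open>Where g vanishes so does g', and real division by zero gives 0, in agreement
    with the convention 0/0 = 0.\<close>
  have "weight_ratio \<alpha> (g' (Suc j)) (g (Suc j)) = ennreal (r (Suc j))" for j
  proof (cases "g (Suc j) = 0")
    case True
    then show ?thesis using g0[of "Suc j"] by (simp add: weight_ratio_def r_def)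
  next
    case False
    then show ?thesis using g[of "Suc j"] by (simp add: weight_ratio_def r_def divide_ennreal e_def)
  qed
  then have rs: "summable (\<lambda>j. r (Suc j))"
    using sr r0 by (intro summable_suminf_not_top) auto
  have gs: "summable (\<lambda>j. g (Suc j) powr lam)"
    using sg by (intro summable_suminf_not_top) auto
  \<comment> \<open>Summability of g^lam bounds g by some G, so g' = g^e r is dominated by a
    constant multiple of the summable ratios r.\<close>
  have g's: "summable (\<lambda>j. g' (Suc j))"
  proof -
    define G where "G = suminf (\<lambda>j. g (Suc j) powr lam) powr (1 / lam)"
    have "g (Suc j) \<le> G" for j
    proof -
      have "g (Suc j) powr lam \<le> suminf (\<lambda>j. g (Suc j) powr lam)"
        using sum_le_suminf[OF gs, of "{j}"] by simp
      then have "(g (Suc j) powr lam) powr (1 / lam) \<le> G"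
        unfolding G_def using lam0 by (intro powr_mono2) auto
      then show ?thesis using lam0 g[of "Suc j"] by (simp add: powr_powr)
    qed
    then have "g' (Suc j) \<le> G powr e * r (Suc j)" for j
    proof (cases "g (Suc j) = 0")
      case False
      then have "g' (Suc j) = g (Suc j) powr e * r (Suc j)" by (simp add: r_def)
      also have "\<dots> \<le> G powr e * r (Suc j)"
        using \<open>\<And>j. g (Suc j) \<le> G\<close> e g r0 by (intro mult_right_mono powr_mono2) auto
      finally show ?thesis .
    qed (use g0[of "Suc j"] r0[of "Suc j"] in simp)
    then show ?thesis
      using g by (intro summable_comparison_test[OF _ summable_mult[OF rs, of "G powr e"]]) auto
  qed
  define Z where "Z = 2 * zeta (2 * \<alpha> * lam)"
  have Z: "Z \<ge> 0" using zeta_nonneg[OF t] by (simp add: Z_def)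
  define A where "A = exp (suminf (\<lambda>j. g (Suc j) powr lam * Z))"
  define B where "B = exp (suminf (\<lambda>j. g' (Suc j) * 2))"
  \<comment> \<open>The rate is chosen so that at T = 2 log_2 N the exponential becomes
    N^(\<delta>/2).\<close>
  obtain K where K: "K > 0"
    "\<And>n T. T \<ge> 0 \<Longrightarrow> (\<Prod>j<n. 1 + r (Suc j) * T) \<le> K * exp (\<delta> * ln 2 / 4 * T)"
    using prod_one_plus_mult_le_exp[of "\<lambda>j. r (Suc j)" "\<delta> * ln 2 / 4"] r0 rs \<delta> by auto
  define D where "D = K * 2 powr (\<delta> / 2)"
  have "\<exists>C>0. \<forall>s N z. s \<ge> 1 \<longrightarrow> N \<ge> 2 \<longrightarrow> cbc_output \<alpha> \<gamma> N s z \<longrightarrow>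
           weighted_star_discrepancy \<gamma>' s (lattice_points s N z)
             \<le> C * real s powr (max 0 (0 / (2 * \<alpha> * lam) + 0))
                 * real (totient N) powr (- 1 / (2 * \<alpha> * lam) + \<delta>)"
  proof (rule cbc_discrepancy_bound[OF \<alpha> w w' mono lam \<delta>, where A = A and B = B and D = D])
    fix s :: nat assume s: "s \<ge> 1"
    have "(\<Sum>u\<in>coord_sets s. \<gamma> u powr lam * Z ^ card u) = (\<Sum>u\<in>coord_sets s. \<Prod>j\<in>u. g j powr lam * Z)"
      by (intro sum.cong refl)
         (simp add: pu(1)[OF coord_sets_weight_index] prod_powr_distrib prod.distrib)
    also have "\<dots> \<le> (\<Prod>j=1..s. 1 + g j powr lam * Z)"
      using g Z by (intro sum_coord_sets_prod_le) auto
    also have "\<dots> \<le> A"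
      unfolding prod_atLeast1_atMost A_def using Z gs
      by (intro prod_one_plus_le_exp_suminf summable_mult2) auto
    finally show "(\<Sum>u\<in>coord_sets s. \<gamma> u powr lam * (2 * zeta (2 * \<alpha> * lam)) ^ card u) \<le> A * real s powr 0"
      using s by (simp add: Z_def)
  next
    fix s :: nat and u assume s: "s \<ge> 1" and u: "u \<in> coord_sets s"
    note uw = coord_sets_weight_index[OF u]
    \<comment> \<open>The factor |u| is not multiplicative in u; its bound 2^|u| is, and keeps the
      product structure.\<close>
    have "real (card u) \<le> 2 ^ card u" by (simp add: less_imp_le)
    then have "\<gamma>' u * real (card u) \<le> \<gamma>' u * 2 ^ card u"
      using w' uw by (intro mult_left_mono) (auto simp: weights_def)
    also have "\<dots> = (\<Prod>j\<in>u. g' j * 2)" by (simp add: pu(2)[OF uw] prod.distrib)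
    also have "\<dots> \<le> (\<Sum>u\<in>coord_sets s. \<Prod>j\<in>u. g' j * 2)"
    proof (rule member_le_sum[OF u])
      show "0 \<le> (\<Prod>j\<in>v. g' j * 2)" if "v \<in> coord_sets s - {u}" for v
        using that g(2) u1[OF coord_sets_weight_index[of v s]] by (intro prod_nonneg) auto
    qed (rule finite_coord_sets)
    also have "\<dots> \<le> (\<Prod>j=1..s. 1 + g' j * 2)"
      using g by (intro sum_coord_sets_prod_le) auto
    also have "\<dots> \<le> B"
      unfolding prod_atLeast1_atMost B_def using g g's
      by (intro prod_one_plus_le_exp_suminf summable_mult2) auto
    finally show "\<gamma>' u * real (card u) \<le> B * real s powr 0" using s by simp
  next
    fix u assume u: "u \<in> weight_index" "\<gamma> u = 0"
    have fin: "finite u" using u by (simp add: weight_index_def)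
    obtain j where "j \<in> u" "g j = 0" using u fin by (auto simp: pu(1)[OF u(1)])
    then show "\<gamma>' u = 0" using g0[OF u1[OF u(1)]] fin by (auto simp: pu(2)[OF u(1)])
  next
    fix s N :: nat and u assume s: "s \<ge> 1" and N: "N \<ge> 1" and u: "u \<in> coord_sets s" "\<gamma> u > 0"
    note uw = coord_sets_weight_index[OF u(1)]
    define T where "T = 2 * log 2 (real N)"
    have T: "T \<ge> 0" using N by (simp add: T_def)
    have "\<gamma>' u / \<gamma> u powr e * T ^ card u = (\<Prod>j\<in>u. r j * T)"
      by (simp add: pu[OF uw] r_def prod_powr_distrib prod.distrib prod_dividef)
    also have "\<dots> \<le> (\<Sum>u\<in>coord_sets s. \<Prod>j\<in>u. r j * T)"
    proof (rule member_le_sum[OF u(1)])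
      show "0 \<le> (\<Prod>j\<in>v. r j * T)" if "v \<in> coord_sets s - {u}" for v
        using that r0 T u1[OF coord_sets_weight_index[of v s]] by (intro prod_nonneg) auto
    qed (rule finite_coord_sets)
    also have "\<dots> \<le> (\<Prod>j=1..s. 1 + r j * T)"
      using r0 T by (intro sum_coord_sets_prod_le) auto
    also have "\<dots> \<le> K * exp (\<delta> * ln 2 / 4 * T)"
      unfolding prod_atLeast1_atMost using T by (rule K(2))
    also have "exp (\<delta> * ln 2 / 4 * T) = real N powr (\<delta> / 2)"
      using N by (simp add: T_def log_def powr_def)
    also have "K * \<dots> \<le> K * (2 powr (\<delta> / 2) * real (totient N) powr \<delta>)"
      using K(1) N \<delta> by (intro mult_left_mono powr_le_totient_powr) auto
    finally show "\<gamma>' u / \<gamma> u powr (1 / (2 * \<alpha>)) * (2 * log 2 (real N)) ^ card u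
        \<le> D * real s powr 0 * real (totient N) powr \<delta>"
      using s by (simp add: D_def T_def e_def mult.assoc)
  qed (use K(1) in \<open>auto simp: A_def B_def D_def\<close>)
  then obtain C where C: "C > 0" "\<And>s N z. s \<ge> 1 \<Longrightarrow> N \<ge> 2 \<Longrightarrow> cbc_output \<alpha> \<gamma> N s z \<Longrightarrow>
           weighted_star_discrepancy \<gamma>' s (lattice_points s N z)
             \<le> C * real s powr (max 0 (0 / (2 * \<alpha> * lam) + 0))
                 * real (totient N) powr (- 1 / (2 * \<alpha> * lam) + \<delta>)" by blast
  show ?thesis
  proof (intro exI[of _ C] conjI C(1) allI impI)
    fix s N :: nat and z assume "s \<ge> 1" "N \<ge> 2" "cbc_output \<alpha> \<gamma> N s z"
    then show "weighted_star_discrepancy \<gamma>' s (lattice_points s N z)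
             \<le> C * real (totient N) powr (- 1 / (2 * \<alpha> * lam) + \<delta>)"
      using C(2)[of s N z] by simp
  qed
qed

text \<open>Since \<delta> may exceed 1/(2 \<alpha> lam), the power of the totient in the main
  estimate may grow with N. Boundedness comes instead from the trivial bound 1 on the local
  discrepancy, together with \<open>card u \<ge> 1\<close>.\<close>

lemma weighted_star_discrepancy_le_weights:
  assumes w: "weights \<gamma>" and s: "s \<ge> 1" and N: "N > 0"
  shows "weighted_star_discrepancy \<gamma> s (lattice_points s N z) \<le> (\<Sum>u\<in>coord_sets s. \<gamma> u * real (card u))"
proof (rule weighted_star_discrepancy_le[OF s w, where b = "\<lambda>_. 1"])
  have \<gamma>0: "\<gamma> u \<ge> 0" if "u \<in> coord_sets s" for u
    using w coord_sets_weight_index[OF that] by (auto simp: weights_def)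
  then show "(\<Sum>u\<in>coord_sets s. \<gamma> u * real (card u)) \<ge> 0" by (intro sum_nonneg) auto
  fix u assume u: "u \<in> coord_sets s"
  have "card u > 0" using u finite_coord_set[OF u] by (auto simp: coord_sets_def card_gt_0_iff)
  then have "1 \<le> real (card u)" by simp
  then have "\<gamma> u * 1 \<le> \<gamma> u * real (card u)" using \<gamma>0[OF u] by (intro mult_left_mono)
  also have "\<dots> \<le> (\<Sum>u\<in>coord_sets s. \<gamma> u * real (card u))"
    using u finite_coord_sets \<gamma>0 by (intro member_le_sum[where f = "\<lambda>u. \<gamma> u * real (card u)"]) auto
  finally show "\<gamma> u * 1 \<le> (\<Sum>u\<in>coord_sets s. \<gamma> u * real (card u))" .
qed (use N in \<open>auto intro: local_discrepancy_le_1\<close>)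

lemma general_weights_bound_uniform:
  assumes \<alpha>: "\<alpha> > 1 / 2" and w: "weights \<gamma>" and w': "weights \<gamma>'"
    and mono: "\<And>u v. u \<in> weight_index \<Longrightarrow> v \<in> weight_index \<Longrightarrow> v \<subseteq> u \<Longrightarrow> \<gamma> v \<ge> \<gamma> u"
    and lam: "1 / (2 * \<alpha>) < lam" "lam \<le> 1" and \<delta>: "\<delta> > 0"
    and A: "(SUP s\<in>{1::nat..}. ennreal
           (\<Sum>u\<in>coord_sets s. \<gamma> u powr lam * (2 * zeta (2 * \<alpha> * lam)) ^ card u)) < \<infinity>"
    and B: "(SUP s\<in>{1::nat..}. ennreal (\<Sum>u\<in>coord_sets s. \<gamma>' u * real (card u))) < \<infinity>"
    and D: "(SUP (s, N)\<in>{1::nat..} \<times> {1::nat..}.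
           ennreal (1 / real (totient N) powr \<delta>) *
           (\<Sum>u\<in>coord_sets s.
              weight_ratio \<alpha> (\<gamma>' u) (\<gamma> u) * ennreal ((2 * log 2 (real N)) ^ card u))) < \<infinity>"
  shows "\<exists>C>0. \<forall>s N z. s \<ge> 1 \<longrightarrow> N \<ge> 2 \<longrightarrow> cbc_output \<alpha> \<gamma> N s z \<longrightarrow>
           weighted_star_discrepancy \<gamma>' s (lattice_points s N z)
             \<le> C * real (totient N) powr (- 1 / (2 * \<alpha> * lam) + \<delta>)
           \<and> weighted_star_discrepancy \<gamma>' s (lattice_points s N z) \<le> C"
proof -
  have s0: "real s powr 0 = 1" if "s \<in> {1::nat..}" for s using that by simp
  have "\<exists>C>0. \<forall>s N z. s \<ge> 1 \<longrightarrow> N \<ge> 2 \<longrightarrow> cbc_output \<alpha> \<gamma> N s z \<longrightarrow>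
           weighted_star_discrepancy \<gamma>' s (lattice_points s N z)
             \<le> C * real s powr (max 0 (0 / (2 * \<alpha> * lam) + 0))
                 * real (totient N) powr (- 1 / (2 * \<alpha> * lam) + \<delta>)"
  proof (rule general_weights_bound[OF \<alpha> w w' mono lam \<delta>])
    \<comment> \<open>\<open>SUP_mono'\<close> compares the terms at every natural number. At s = 0
      the value of \<open>0 powr 0\<close> is 0, which makes the left term 0, so the inequality
      still holds.\<close>
    show "(SUP s\<in>{1::nat..}. ennreal (1 / real s powr 0 *
           (\<Sum>u\<in>coord_sets s. \<gamma> u powr lam * (2 * zeta (2 * \<alpha> * lam)) ^ card u))) < \<infinity>"
      by (rule le_less_trans[OF _ A], rule SUP_mono') simp
    show "(SUP s\<in>{1::nat..}. ennreal (1 / real s powr 0 *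
           (\<Sum>u\<in>coord_sets s. \<gamma>' u * real (card u)))) < \<infinity>"
      by (rule le_less_trans[OF _ B], rule SUP_mono') simp
    have "(SUP (s, N)\<in>{1::nat..} \<times> {1::nat..}.
           ennreal (1 / (real s powr 0 * real (totient N) powr \<delta>)) *
           (\<Sum>u\<in>coord_sets s.
              weight_ratio \<alpha> (\<gamma>' u) (\<gamma> u) * ennreal ((2 * log 2 (real N)) ^ card u)))
        = (SUP (s, N)\<in>{1::nat..} \<times> {1::nat..}.
           ennreal (1 / real (totient N) powr \<delta>) *
           (\<Sum>u\<in>coord_sets s.
              weight_ratio \<alpha> (\<gamma>' u) (\<gamma> u) * ennreal ((2 * log 2 (real N)) ^ card u)))"
      by (rule SUP_cong) auto
    then show "(SUP (s, N)\<in>{1::nat..} \<times> {1::nat..}.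
           ennreal (1 / (real s powr 0 * real (totient N) powr \<delta>)) *
           (\<Sum>u\<in>coord_sets s.
              weight_ratio \<alpha> (\<gamma>' u) (\<gamma> u) * ennreal ((2 * log 2 (real N)) ^ card u))) < \<infinity>"
      using D by (simp only:)
  qed
  then obtain C where C: "C > 0" "\<And>s N z. s \<ge> 1 \<Longrightarrow> N \<ge> 2 \<Longrightarrow> cbc_output \<alpha> \<gamma> N s z \<Longrightarrow>
           weighted_star_discrepancy \<gamma>' s (lattice_points s N z)
             \<le> C * real s powr (max 0 (0 / (2 * \<alpha> * lam) + 0))
                 * real (totient N) powr (- 1 / (2 * \<alpha> * lam) + \<delta>)" by blast
  obtain MB where MB: "MB \<ge> 0" "\<And>s. s \<in> {1::nat..} \<Longrightarrow> ennreal
           (\<Sum>u\<in>coord_sets s. \<gamma>' u * real (card u)) \<le> ennreal MB"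
    using SUP_ennreal_bound[OF B] by blast
  show ?thesis
  \<comment> \<open>One constant for both claims: C for the rate in the totient, MB for
    boundedness.\<close>
  proof (intro exI[of _ "max C MB"] conjI allI impI)
    fix s N :: nat and z assume *: "s \<ge> 1" "N \<ge> 2" "cbc_output \<alpha> \<gamma> N s z"
    have "weighted_star_discrepancy \<gamma>' s (lattice_points s N z)
             \<le> C * real (totient N) powr (- 1 / (2 * \<alpha> * lam) + \<delta>)"
      using C(2)[OF *] * by simp
    also have "\<dots> \<le> max C MB * real (totient N) powr (- 1 / (2 * \<alpha> * lam) + \<delta>)"
      by (intro mult_right_mono) auto
    finally show "weighted_star_discrepancy \<gamma>' s (lattice_points s N z) \<le> \<dots>" .
    have "weighted_star_discrepancy \<gamma>' s (lattice_points s N z) \<le> (\<Sum>u\<in>coord_sets s. \<gamma>' u * real (card u))"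
      using * by (intro weighted_star_discrepancy_le_weights[OF w']) auto
    also have "\<dots> \<le> MB" using iffD1[OF ennreal_le_iff[OF MB(1)] MB(2)[of s]] * by simp
    finally show "weighted_star_discrepancy \<gamma>' s (lattice_points s N z) \<le> max C MB" by simp
  qed (use C(1) in auto)
qed

theorem corollary2:
  fixes \<alpha> :: real and \<gamma> \<gamma>' :: "nat set \<Rightarrow> real"
  assumes "\<alpha> > 1 / 2"
    and "weights \<gamma>" and "weights \<gamma>'"
    and "\<And>u v. u \<in> weight_index \<Longrightarrow> v \<in> weight_index \<Longrightarrow> v \<subseteq> u \<Longrightarrow> \<gamma> v \<ge> \<gamma> u"
  shows
    "(\<forall>lam \<delta> q q' q'' :: real.
        lam \<ge> 0 \<longrightarrow> \<delta> \<ge> 0 \<longrightarrow> q \<ge> 0 \<longrightarrow> q' \<ge> 0 \<longrightarrow> q'' \<ge> 0 \<longrightarrow>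
        1 / (2 * \<alpha>) < lam \<longrightarrow> lam < 1 \<longrightarrow> 0 < \<delta> \<longrightarrow> \<delta> < 1 / (\<alpha> * lam) \<longrightarrow>
        (SUP s\<in>{1::nat..}. ennreal (1 / real s powr q *
           (\<Sum>u\<in>coord_sets s. \<gamma> u powr lam * (2 * zeta (2 * \<alpha> * lam)) ^ card u))) < \<infinity> \<longrightarrow>
        (SUP s\<in>{1::nat..}. ennreal (1 / real s powr q' *
           (\<Sum>u\<in>coord_sets s. \<gamma>' u * real (card u)))) < \<infinity> \<longrightarrow>
        (SUP (s, N)\<in>{1::nat..} \<times> {1::nat..}.
           ennreal (1 / (real s powr q'' * real (totient N) powr \<delta>)) *
           (\<Sum>u\<in>coord_sets s.
              weight_ratio \<alpha> (\<gamma>' u) (\<gamma> u) * ennreal ((2 * log 2 (real N)) ^ card u))) < \<infinity> \<longrightarrow>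
        (\<exists>C>0. \<forall>s N z. s \<ge> 1 \<longrightarrow> N \<ge> 2 \<longrightarrow> cbc_output \<alpha> \<gamma> N s z \<longrightarrow>
           weighted_star_discrepancy \<gamma>' s (lattice_points s N z)
             \<le> C * real s powr (max q' (q / (2 * \<alpha> * lam) + q''))
                 * real (totient N) powr (- 1 / (2 * \<alpha> * lam) + \<delta>)))
     \<and>
     (\<forall>lam \<delta> :: real.
        1 / (2 * \<alpha>) < lam \<longrightarrow> lam < 1 \<longrightarrow> 0 < \<delta> \<longrightarrow> \<delta> < 1 / (\<alpha> * lam) \<longrightarrow>
        (SUP s\<in>{1::nat..}. ennreal
           (\<Sum>u\<in>coord_sets s. \<gamma> u powr lam * (2 * zeta (2 * \<alpha> * lam)) ^ card u)) < \<infinity> \<longrightarrow>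
        (SUP s\<in>{1::nat..}. ennreal (\<Sum>u\<in>coord_sets s. \<gamma>' u * real (card u))) < \<infinity> \<longrightarrow>
        (SUP (s, N)\<in>{1::nat..} \<times> {1::nat..}.
           ennreal (1 / real (totient N) powr \<delta>) *
           (\<Sum>u\<in>coord_sets s.
              weight_ratio \<alpha> (\<gamma>' u) (\<gamma> u) * ennreal ((2 * log 2 (real N)) ^ card u))) < \<infinity> \<longrightarrow>
        (\<exists>C>0. \<forall>s N z. s \<ge> 1 \<longrightarrow> N \<ge> 2 \<longrightarrow> cbc_output \<alpha> \<gamma> N s z \<longrightarrow>
           weighted_star_discrepancy \<gamma>' s (lattice_points s N z)
             \<le> C * real (totient N) powr (- 1 / (2 * \<alpha> * lam) + \<delta>)
           \<and> weighted_star_discrepancy \<gamma>' s (lattice_points s N z) \<le> C))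
     \<and>
     (\<forall>(g :: nat \<Rightarrow> real) (g' :: nat \<Rightarrow> real) (lam :: real).
        product_weights \<gamma> g \<longrightarrow> product_weights \<gamma>' g' \<longrightarrow>
        1 / (2 * \<alpha>) < lam \<longrightarrow> lam \<le> 1 \<longrightarrow>
        (\<Sum>j. ennreal (g (Suc j) powr lam)) < \<infinity> \<longrightarrow>
        (\<Sum>j. weight_ratio \<alpha> (g' (Suc j)) (g (Suc j))) < \<infinity> \<longrightarrow>
        (\<forall>\<delta>>0. \<exists>C>0. \<forall>s N z. s \<ge> 1 \<longrightarrow> N \<ge> 2 \<longrightarrow> cbc_output \<alpha> \<gamma> N s z \<longrightarrow>
           weighted_star_discrepancy \<gamma>' s (lattice_points s N z)
             \<le> C * real (totient N) powr (- 1 / (2 * \<alpha> * lam) + \<delta>)))"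
proof (intro conjI allI impI)
  fix lam \<delta> q q' q'' :: real
  assume "1 / (2 * \<alpha>) < lam" "lam < 1" "0 < \<delta>"
    and "(SUP s\<in>{1::nat..}. ennreal (1 / real s powr q *
           (\<Sum>u\<in>coord_sets s. \<gamma> u powr lam * (2 * zeta (2 * \<alpha> * lam)) ^ card u))) < \<infinity>"
    and "(SUP s\<in>{1::nat..}. ennreal (1 / real s powr q' *
           (\<Sum>u\<in>coord_sets s. \<gamma>' u * real (card u)))) < \<infinity>"
    and "(SUP (s, N)\<in>{1::nat..} \<times> {1::nat..}.
           ennreal (1 / (real s powr q'' * real (totient N) powr \<delta>)) *
           (\<Sum>u\<in>coord_sets s.
              weight_ratio \<alpha> (\<gamma>' u) (\<gamma> u) * ennreal ((2 * log 2 (real N)) ^ card u))) < \<infinity>"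
  then show "\<exists>C>0. \<forall>s N z. s \<ge> 1 \<longrightarrow> N \<ge> 2 \<longrightarrow> cbc_output \<alpha> \<gamma> N s z \<longrightarrow>
           weighted_star_discrepancy \<gamma>' s (lattice_points s N z)
             \<le> C * real s powr (max q' (q / (2 * \<alpha> * lam) + q''))
                 * real (totient N) powr (- 1 / (2 * \<alpha> * lam) + \<delta>)"
    by (intro general_weights_bound[OF assms]) simp_all
next
  fix lam \<delta> :: real
  assume "1 / (2 * \<alpha>) < lam" "lam < 1" "0 < \<delta>"
    and "(SUP s\<in>{1::nat..}. ennreal
           (\<Sum>u\<in>coord_sets s. \<gamma> u powr lam * (2 * zeta (2 * \<alpha> * lam)) ^ card u)) < \<infinity>"
    and "(SUP s\<in>{1::nat..}. ennreal (\<Sum>u\<in>coord_sets s. \<gamma>' u * real (card u))) < \<infinity>"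
    and "(SUP (s, N)\<in>{1::nat..} \<times> {1::nat..}.
           ennreal (1 / real (totient N) powr \<delta>) *
           (\<Sum>u\<in>coord_sets s.
              weight_ratio \<alpha> (\<gamma>' u) (\<gamma> u) * ennreal ((2 * log 2 (real N)) ^ card u))) < \<infinity>"
  then show "\<exists>C>0. \<forall>s N z. s \<ge> 1 \<longrightarrow> N \<ge> 2 \<longrightarrow> cbc_output \<alpha> \<gamma> N s z \<longrightarrow>
           weighted_star_discrepancy \<gamma>' s (lattice_points s N z)
             \<le> C * real (totient N) powr (- 1 / (2 * \<alpha> * lam) + \<delta>)
           \<and> weighted_star_discrepancy \<gamma>' s (lattice_points s N z) \<le> C"
    by (intro general_weights_bound_uniform[OF assms]) simp_all
next
  fix g g' :: "nat \<Rightarrow> real" and lam \<delta> :: real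
  assume "product_weights \<gamma> g" "product_weights \<gamma>' g'" "1 / (2 * \<alpha>) < lam" "lam \<le> 1"
    "(\<Sum>j. ennreal (g (Suc j) powr lam)) < \<infinity>"
    "(\<Sum>j. weight_ratio \<alpha> (g' (Suc j)) (g (Suc j))) < \<infinity>" "0 < \<delta>"
  then show "\<exists>C>0. \<forall>s N z. s \<ge> 1 \<longrightarrow> N \<ge> 2 \<longrightarrow> cbc_output \<alpha> \<gamma> N s z \<longrightarrow>
           weighted_star_discrepancy \<gamma>' s (lattice_points s N z)
             \<le> C * real (totient N) powr (- 1 / (2 * \<alpha> * lam) + \<delta>)"
    by (intro product_weights_bound[OF assms, where g = g and g' = g']) assumption+
qed

end
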